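(* Let $\Sigma$ be a finitary signature and $\mathcal{E}\subseteq T_\Sigma(V)\times T_\Sigma(V)$ a set of inequalities, let $U:\mathbf{DTop}(\Sigma,\mathcal{E})\to\mathbf{DTop}$ be the forgetful functor and $F$ its left adjoint. Let $X$ be a continuous space. Then $UF(X)$ is a continuous space, and the unit $\eta:X\to UF(X)$ as well as the $\Sigma$-operations of $F(X)$ are way-below preserving.
   Context: All topological spaces are $T_0$; order-theoretic notions on a space refer to the specialization order $x\sqsubseteq y$ iff $x\in\overline{\{y\}}$. A directed subset $D\subseteq X$ converges to $x$, written $D\to x$, if $D\cap U\neq\emptyset$ for every open neighbourhood $U$ of $x$. A subset $U\subseteq X$ is directed-open if for every directed $D\subseteq X$ and $x\in X$ with $D\to x$, $x\in U$ implies $D\cap U\ne\emptyset$. A directed space is a $T_0$ space in which every directed-open set is open. For a $T_0$ space $Y$, $\mathcal{D}Y$ is the set of $Y$ with the topology of all directed-open subsets of $Y$ (a directed space). $\mathbf{DTop}$ is the category of directed spaces and continuous maps; its categorical product is $X\otimes Y=\mathcal{D}(X\times Y)$ (and similarly for families), where $\times$ is the topological product. For a directed space $X$, $X^n$ denotes the $n$-fold product $X\otimes\dots\otimes X$. In a directed space, $x\ll y$ means that for every directed $D$ with $D\to y$ there is $d\in D$ with $x\sqsubseteq d$. A continuous space is a directed space $X$ such that for each $x\in X$ there is a directed subset $D\subseteq\{y:y\ll x\}$ with $D\to x$. A continuous map $f:X\to Y$ between continuous spaces is way-below preserving if $x\ll y$ implies $f(x)\ll f(y)$. A finitary signature $\Sigma=\langle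 I,\alpha\rangle$ is a set $I$ of operation symbols with an arity map $\alpha:I\to\mathbb{N}$, $n_i:=\alpha(i)$. A $\Sigma$-algebra $\langle A,\{f_i\}_I\rangle$ is a set $A$ with maps $f_i:A^{n_i}\to A$; homomorphisms are maps commuting with the operations. $T_\Sigma(V)$ is the term algebra over a fixed countable set $V$ of variables; each map $h:V\to A$ into a $\Sigma$-algebra extends uniquely to a homomorphism $\overline h:T_\Sigma(V)\to A$. A dtop-algebra is a $\Sigma$-algebra whose carrier is a directed space and whose operations $f_i:A^{n_i}\to A$ are continuous. A pair $\langle\tau_1,\tau_2\rangle\in\mathcal{E}$ stands for the inequality $\tau_1\le\tau_2$, which holds in $A$ if $\overline h(\tau_1)\sqsubseteq\overline h(\tau_2)$ for every map $h:V\to A$. $\mathbf{DTop}(\Sigma,\mathcal{E})$ is the category of all dtop-algebras with signature $\Sigma$ satisfying all inequalities in $\mathcal{E}$, with continuous homomorphisms as morphisms; $U$ sends an algebra to its carrier space. The left adjoint $F$ of $U$ exists for all $\Sigma,\mathcal{E}$; $F(X)$ is the free algebra over $X$, i.e. every continuous map from $X$ to the carrier of an object $B$ of $\mathbf{DTop}(\Sigma,\mathcal{E})$ factors uniquely as $\overline f\circ\eta$ with $\overline f:F(X)\to B$ a continuous homomorphism. *)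

theory Defs
  imports "HOL-Analysis.Analysis"
begin

section \<open>Directed spaces\<close>

definition spec_le :: "'a topology \<Rightarrow> 'a \<Rightarrow> 'a \<Rightarrow> bool" where
  "spec_le X x y \<longleftrightarrow> x \<in> topspace X \<and> y \<in> topspace X \<and> x \<in> X closure_of {y}"

definition directed_in :: "'a topology \<Rightarrow> 'a set \<Rightarrow> bool" where
  "directed_in X D \<longleftrightarrow> D \<subseteq> topspace X \<and> D \<noteq> {} \<and>
     (\<forall>a\<in>D. \<forall>b\<in>D. \<exists>c\<in>D. spec_le X a c \<and> spec_le X b c)"

definition dconv :: "'a topology \<Rightarrow> 'a set \<Rightarrow> 'a \<Rightarrow> bool" where
  "dconv X D x \<longleftrightarrow> directed_in X D \<and> x \<in> topspace X \<and>
     (\<forall>U. openin X U \<and> x \<in> U \<longrightarrow> D \<inter> U \<noteq> {})"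

definition directed_open :: "'a topology \<Rightarrow> 'a set \<Rightarrow> bool" where
  "directed_open X U \<longleftrightarrow> U \<subseteq> topspace X \<and>
     (\<forall>D x. dconv X D x \<and> x \<in> U \<longrightarrow> D \<inter> U \<noteq> {})"

definition directed_space :: "'a topology \<Rightarrow> bool" where
  "directed_space X \<longleftrightarrow> t0_space X \<and> (\<forall>U. directed_open X U \<longrightarrow> openin X U)"

definition dtop_of :: "'a topology \<Rightarrow> 'a topology" where
  "dtop_of Y = topology (directed_open Y)"

lemma directed_open_upper:
  assumes U: "directed_open X U" and x: "x \<in> U" and le: "spec_le X x y"
  shows "y \<in> U"
proof -
  have y: "y \<in> topspace X" and cl: "x \<in> X closure_of {y}" and x': "x \<in> topspace X"
    using le by (auto simp: spec_le_def)
  have "spec_le X y y"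
    using y by (auto simp: spec_le_def in_closure_of)
  then have "dconv X {y} x"
    using y cl x' by (auto simp: dconv_def directed_in_def in_closure_of)
  then show ?thesis
    using U x by (force simp: directed_open_def)
qed

lemma istopology_directed_open: "istopology (directed_open X)"
  unfolding istopology_def
proof (intro conjI allI impI)
  fix S T assume S: "directed_open X S" and T: "directed_open X T"
  show "directed_open X (S \<inter> T)"
    unfolding directed_open_def
  proof (intro conjI allI impI)
    show "S \<inter> T \<subseteq> topspace X" using S by (auto simp: directed_open_def)
    fix D x assume D: "dconv X D x \<and> x \<in> S \<inter> T"
    obtain a where a: "a \<in> D" "a \<in> S" using D S by (force simp: directed_open_def)
    obtain b where b: "b \<in> D" "b \<in> T" using D T by (force simp: directed_open_def)
    obtain c where c: "c \<in> D" "spec_le X a c" "spec_le X b c"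
      using D a b unfolding dconv_def directed_in_def by meson
    then have "c \<in> S \<inter> T"
      using directed_open_upper[OF S a(2)] directed_open_upper[OF T b(2)] by blast
    then show "D \<inter> (S \<inter> T) \<noteq> {}" using c(1) by blast
  qed
next
  fix K assume K: "\<forall>S\<in>K. directed_open X S"
  show "directed_open X (\<Union>K)"
    unfolding directed_open_def
  proof (intro conjI allI impI)
    show "\<Union>K \<subseteq> topspace X" using K by (auto simp: directed_open_def)
    fix D x assume D: "dconv X D x \<and> x \<in> \<Union>K"
    then obtain S where S: "S \<in> K" "x \<in> S" by blast
    then have "D \<inter> S \<noteq> {}" using D K by (auto simp: directed_open_def)
    then show "D \<inter> \<Union>K \<noteq> {}" using S(1) by blast
  qed
qed

lemma openin_dtop_of [simp]: "openin (dtop_of X) U \<longleftrightarrow> directed_open X U"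
  by (simp add: dtop_of_def istopology_directed_open topology_inverse')

lemma topspace_dtop_of [simp]: "topspace (dtop_of X) = topspace X"
proof
  show "topspace (dtop_of X) \<subseteq> topspace X"
    by (metis directed_open_def openin_dtop_of openin_topspace)
  have "openin (dtop_of X) (topspace X)"
    by (auto simp: directed_open_def dconv_def directed_in_def)
  then show "topspace X \<subseteq> topspace (dtop_of X)"
    by (rule openin_subset)
qed

text \<open>Points of the \<open>n\<close>-fold power in the category of directed spaces are the extensional
  functions from \<open>{..<n}\<close> into the space; for \<open>n = 0\<close> this is a one-point space.\<close>

definition dtop_power :: "'a topology \<Rightarrow> nat \<Rightarrow> (nat \<Rightarrow> 'a) topology" where
  "dtop_power X n = dtop_of (product_topology (\<lambda>_. X) {..<n})"

definition way_below :: "'a topology \<Rightarrow> 'a \<Rightarrow> 'a \<Rightarrow> bool" where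
  "way_below X x y \<longleftrightarrow> x \<in> topspace X \<and> y \<in> topspace X \<and>
     (\<forall>D. dconv X D y \<longrightarrow> (\<exists>d\<in>D. spec_le X x d))"

definition continuous_space :: "'a topology \<Rightarrow> bool" where
  "continuous_space X \<longleftrightarrow> directed_space X \<and>
     (\<forall>x\<in>topspace X. \<exists>D. D \<subseteq> {y. way_below X y x} \<and> dconv X D x)"

definition way_below_preserving :: "'a topology \<Rightarrow> 'b topology \<Rightarrow> ('a \<Rightarrow> 'b) \<Rightarrow> bool" where
  "way_below_preserving X Y f \<longleftrightarrow>
     continuous_space X \<and> continuous_space Y \<and> continuous_map X Y f \<and>
     (\<forall>x y. way_below X x y \<longrightarrow> way_below Y (f x) (f y))"

section \<open>Algebras and inequalities\<close>

text \<open>A signature is a set \<open>I\<close> of operation symbols with an arity map \<open>ar\<close>. It is kept as a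
  set, not a whole type, so that it may be empty. The datatype of raw terms contains ill-formed
  terms; \<open>wf_terms I ar W\<close> is the term algebra over the variables \<open>W\<close>.\<close>

datatype ('i, 'v) trm = Var 'v | Op 'i "('i, 'v) trm list"

inductive_set wf_terms :: "'i set \<Rightarrow> ('i \<Rightarrow> nat) \<Rightarrow> 'v set \<Rightarrow> ('i, 'v) trm set"
  for I :: "'i set" and ar :: "'i \<Rightarrow> nat" and W :: "'v set" where
  Var: "v \<in> W \<Longrightarrow> Var v \<in> wf_terms I ar W"
| Op: "i \<in> I \<Longrightarrow> length ts = ar i \<Longrightarrow> (\<And>t. t \<in> set ts \<Longrightarrow> t \<in> wf_terms I ar W)
    \<Longrightarrow> Op i ts \<in> wf_terms I ar W"

text \<open>The homomorphic extension of an assignment \<open>h\<close> to terms.\<close>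

primrec term_ext :: "('i \<Rightarrow> (nat \<Rightarrow> 'a) \<Rightarrow> 'a) \<Rightarrow> ('v \<Rightarrow> 'a) \<Rightarrow> ('i, 'v) trm \<Rightarrow> 'a" where
  "term_ext f h (Var v) = h v"
| "term_ext f h (Op i ts) = f i (restrict (nth (map (term_ext f h) ts)) {..<length ts})"

definition dtop_algebra ::
  "'i set \<Rightarrow> ('i \<Rightarrow> nat) \<Rightarrow> 'a topology \<Rightarrow> ('i \<Rightarrow> (nat \<Rightarrow> 'a) \<Rightarrow> 'a) \<Rightarrow> bool" where
  "dtop_algebra I ar A f \<longleftrightarrow> directed_space A \<and>
     (\<forall>i\<in>I. continuous_map (dtop_power A (ar i)) A (f i))"

definition satisfies_ineqs ::
  "(('i, 'v) trm \<times> ('i, 'v) trm) set \<Rightarrow> 'a topology \<Rightarrow> ('i \<Rightarrow> (nat \<Rightarrow> 'a) \<Rightarrow> 'a) \<Rightarrow> bool" where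
  "satisfies_ineqs E A f \<longleftrightarrow>
     (\<forall>(s, t)\<in>E. \<forall>h \<in> UNIV \<rightarrow> topspace A. spec_le A (term_ext f h s) (term_ext f h t))"

definition DTop_obj ::
  "'i set \<Rightarrow> ('i \<Rightarrow> nat) \<Rightarrow> (('i, 'v) trm \<times> ('i, 'v) trm) set \<Rightarrow>
    'a topology \<Rightarrow> ('i \<Rightarrow> (nat \<Rightarrow> 'a) \<Rightarrow> 'a) \<Rightarrow> bool" where
  "DTop_obj I ar E A f \<longleftrightarrow> dtop_algebra I ar A f \<and> satisfies_ineqs E A f"

definition dtop_hom ::
  "'i set \<Rightarrow> ('i \<Rightarrow> nat) \<Rightarrow> 'a topology \<Rightarrow> ('i \<Rightarrow> (nat \<Rightarrow> 'a) \<Rightarrow> 'a) \<Rightarrow>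
    'b topology \<Rightarrow> ('i \<Rightarrow> (nat \<Rightarrow> 'b) \<Rightarrow> 'b) \<Rightarrow> ('a \<Rightarrow> 'b) \<Rightarrow> bool" where
  "dtop_hom I ar A f B g k \<longleftrightarrow> continuous_map A B k \<and>
     (\<forall>i\<in>I. \<forall>a \<in> topspace (dtop_power A (ar i)).
        k (f i a) = g i (restrict (\<lambda>j. k (a j)) {..<ar i}))"

section \<open>Free algebras\<close>

text \<open>The universal property of \<open>\<eta> : X \<rightarrow> A\<close>, with respect to all target algebras whose
  carrier lives on the type \<open>'b\<close>. Extensionality makes maps on the carrier unique as HOL functions.\<close>

definition universal_arrow ::
  "'b itself \<Rightarrow> 'i set \<Rightarrow> ('i \<Rightarrow> nat) \<Rightarrow> (('i, 'v) trm \<times> ('i, 'v) trm) set \<Rightarrow> 'x topology \<Rightarrow>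
    'a topology \<Rightarrow> ('i \<Rightarrow> (nat \<Rightarrow> 'a) \<Rightarrow> 'a) \<Rightarrow> ('x \<Rightarrow> 'a) \<Rightarrow> bool" where
  "universal_arrow _ I ar E X A f \<eta> \<longleftrightarrow>
     (\<forall>(B :: 'b topology) g k. DTop_obj I ar E B g \<and> continuous_map X B k \<longrightarrow>
        (\<exists>!k'. k' \<in> extensional (topspace A) \<and> dtop_hom I ar A f B g k' \<and>
               (\<forall>x\<in>topspace X. k' (\<eta> x) = k x)))"

text \<open>HOL cannot quantify over all types of targets inside a formula, so the universal property
  is required for two types: that of \<open>A\<close> itself and that of raw terms over the points of \<open>X\<close>.
  This determines the free algebra up to isomorphism: a free algebra is generated by the image of
  its unit (the generated subalgebra, with its directed topology, is again an object), hence has an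
  isomorphic copy carried by a set of terms; and the two universal properties give mutually
  inverse homomorphisms between \<open>A\<close> and that copy. Every free algebra in the usual sense satisfies
  this predicate.\<close>

definition free_dtop_algebra ::
  "'i set \<Rightarrow> ('i \<Rightarrow> nat) \<Rightarrow> (('i, 'v) trm \<times> ('i, 'v) trm) set \<Rightarrow> 'x topology \<Rightarrow>
    'a topology \<Rightarrow> ('i \<Rightarrow> (nat \<Rightarrow> 'a) \<Rightarrow> 'a) \<Rightarrow> ('x \<Rightarrow> 'a) \<Rightarrow> bool" where
  "free_dtop_algebra I ar E X A f \<eta> \<longleftrightarrow>
     DTop_obj I ar E A f \<and> continuous_map X A \<eta> \<and>
     universal_arrow TYPE('a) I ar E X A f \<eta> \<and>
     universal_arrow TYPE(('i, 'x) trm) I ar E X A f \<eta>"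

end

theory Submission
  imports Defs
begin

text \<open>
  Let \<open>T\<close> be the set of terms over the points of \<open>X\<close>, and compare terms in two ways: \<open>tm_wb s t\<close>
  says that \<open>s\<close> and \<open>t\<close> have the same shape and that every leaf of \<open>s\<close> is way below the
  corresponding leaf of \<open>t\<close>; \<open>tm_le\<close> is the least preorder that is compatible with the operations,
  extends the order of \<open>X\<close> and makes the inequalities in \<open>E\<close> true. The two interact well
  (\<open>tm_wb_le_trans\<close>): an approximation of a smaller term lies below an approximation of a larger
  one. The only case with content is that of a substitution instance of an inequality. Different
  occurrences of one variable may have been approximated differently, but since approximations of
  a term are directed, they can first be replaced by a common upper bound, after which the
  inequality applies.

  Hence the sets \<open>tm_above s\<close> of terms having an approximation above \<open>s\<close> form a basis of a
  topology on \<open>T\<close>, in which a set is open if it is a \<open>tm_le\<close>-upper set each of whose members has an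
  approximation in the set. Its \<open>T\<^sub>0\<close> reflection, realised on a set of representatives of terms so
  that it lives on the type of terms, is an algebra in the category (\<open>DTop_obj_tm_alg\<close>). It is the free
  algebra: for any algebra \<open>A\<close> over \<open>X\<close>, evaluation of terms is a continuous homomorphism
  (\<open>dtop_hom_ev\<close>), because evaluating all approximations of a term gives a directed set converging to
  its value (\<open>dconv_ev\<close>). If \<open>A\<close> is free, the universal property yields a homomorphism in the other
  direction, and it is inverse to evaluation (\<open>free_inverse\<close>).

  Consequently every element of \<open>A\<close> is the value of a term, and the basic open sets \<open>tm_above s\<close>
  can be transported to \<open>A\<close>. If \<open>tm_wb s t\<close>, the transported set is an open neighbourhood of
  the value of \<open>t\<close> all of whose members lie above the value of \<open>s\<close>; so the value of \<open>s\<close> is way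
  below that of \<open>t\<close> (\<open>free_way_below\<close>). All three claims follow: the values of approximations
  witness continuity of \<open>A\<close>, a variable is the case of the unit, and applying an operation symbol
  to approximations is again an approximation.
\<close>

section \<open>Convergence of directed sets\<close>

lemma spec_le_iff:
  "spec_le X x y \<longleftrightarrow> x \<in> topspace X \<and> y \<in> topspace X \<and> (\<forall>U. openin X U \<longrightarrow> x \<in> U \<longrightarrow> y \<in> U)"
  by (auto simp: spec_le_def in_closure_of)

lemma spec_le_refl: "x \<in> topspace X \<Longrightarrow> spec_le X x x"
  by (simp add: spec_le_iff)

lemma spec_le_trans: "spec_le X x y \<Longrightarrow> spec_le X y z \<Longrightarrow> spec_le X x z"
  by (simp add: spec_le_iff)

lemma dconv_mono: "dconv X D y \<Longrightarrow> spec_le X x y \<Longrightarrow> dconv X D x"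
  unfolding dconv_def spec_le_iff by blast

lemma dconv_singleton: "x \<in> topspace X \<Longrightarrow> dconv X {x} x"
  by (auto simp: dconv_def directed_in_def spec_le_refl)

lemma dconv_bound:
  assumes "dconv X D x" "a \<in> D" "b \<in> D"
  obtains c where "c \<in> D" "spec_le X a c" "spec_le X b c"
  using assms unfolding dconv_def directed_in_def by blast

lemma directed_in_finite_bound:
  assumes "directed_in X D" "finite F" "F \<subseteq> D"
  shows "\<exists>d\<in>D. \<forall>a\<in>F. spec_le X a d"
  using assms(2,3)
proof (induction F)
  case empty
  then show ?case using assms(1) by (auto simp: directed_in_def)
next
  case (insert x F)
  then obtain d where d: "d \<in> D" "\<forall>a\<in>F. spec_le X a d" by auto
  obtain c where "c \<in> D" "spec_le X x c" "spec_le X d c"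
    using assms(1) insert.prems d(1) unfolding directed_in_def by (metis insert_subset)
  then show ?case using d spec_le_trans by (metis insert_iff)
qed

lemma continuous_map_spec_le:
  assumes "continuous_map X Y f" "spec_le X x y"
  shows "spec_le Y (f x) (f y)"
  unfolding spec_le_iff
proof (intro conjI allI impI)
  show "f x \<in> topspace Y" "f y \<in> topspace Y"
    using assms by (auto simp: continuous_map_def spec_le_iff)
  fix U assume U: "openin Y U" "f x \<in> U"
  have "openin X {z \<in> topspace X. f z \<in> U}"
    using assms(1) U(1) by (rule openin_continuous_map_preimage)
  then show "f y \<in> U" using assms(2) U(2) unfolding spec_le_iff by blast
qed

lemma continuous_map_dconv:
  assumes f: "continuous_map X Y f" and D: "dconv X D x"
  shows "dconv Y (f ` D) (f x)"
  unfolding dconv_def directed_in_def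
proof (intro conjI allI impI ballI)
  show "f ` D \<subseteq> topspace Y" "f x \<in> topspace Y" "f ` D \<noteq> {}"
    using assms by (auto simp: continuous_map_def dconv_def directed_in_def)
next
  fix a b assume "a \<in> f ` D" "b \<in> f ` D"
  then obtain a' b' where ab: "a' \<in> D" "b' \<in> D" "a = f a'" "b = f b'" by blast
  then obtain c where "c \<in> D" "spec_le X a' c" "spec_le X b' c"
    using dconv_bound[OF D] by metis
  then show "\<exists>c\<in>f ` D. spec_le Y a c \<and> spec_le Y b c"
    using ab continuous_map_spec_le[OF f] by blast
next
  fix U assume U: "openin Y U \<and> f x \<in> U"
  then have "openin X {z \<in> topspace X. f z \<in> U}"
    using f openin_continuous_map_preimage by blast
  then show "f ` D \<inter> U \<noteq> {}"
    using D U unfolding dconv_def by blast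
qed

lemma openin_imp_directed_open: "openin X U \<Longrightarrow> directed_open X U"
  unfolding directed_open_def dconv_def using openin_subset by blast

text \<open>Directed-open sets are upper sets and include all open sets, so refining the topology to them
  changes neither the specialization order nor, by their very definition, convergence of directed
  sets.\<close>

lemma spec_le_dtop_of [simp]: "spec_le (dtop_of X) = spec_le X"
proof (intro ext iffI)
  fix x y
  show "spec_le (dtop_of X) x y" if "spec_le X x y"
    unfolding spec_le_iff[of "dtop_of X"]
    using that directed_open_upper[of X _ x y] by (simp add: spec_le_iff[of X x y])
  show "spec_le X x y" if "spec_le (dtop_of X) x y"
    using that by (auto simp: spec_le_iff openin_imp_directed_open)
qed

lemma dconv_dtop_of [simp]: "dconv (dtop_of X) = dconv X"
proof (intro ext iffI)
  fix D x
  show "dconv (dtop_of X) D x" if "dconv X D x"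
    unfolding dconv_def[of "dtop_of X"]
  proof (intro conjI allI impI)
    show "directed_in (dtop_of X) D" "x \<in> topspace (dtop_of X)"
      using that by (simp_all add: dconv_def directed_in_def)
    show "D \<inter> U \<noteq> {}" if "openin (dtop_of X) U \<and> x \<in> U" for U
      using that \<open>dconv X D x\<close> unfolding openin_dtop_of directed_open_def by blast
  qed
  show "dconv X D x" if "dconv (dtop_of X) D x"
    using that openin_imp_directed_open[of X]
    by (simp add: dconv_def directed_in_def)
qed

lemma directed_space_dtop_of: "t0_space X \<Longrightarrow> directed_space (dtop_of X)"
  unfolding directed_space_def
proof (intro conjI allI impI)
  assume "t0_space X"
  then show "t0_space (dtop_of X)"
    unfolding t0_space_def topspace_dtop_of openin_dtop_of
    using openin_imp_directed_open[of X] by meson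
  fix U assume "directed_open (dtop_of X) U"
  then show "openin (dtop_of X) U" by (simp add: directed_open_def)
qed

lemma continuous_map_from_dtop_of:
  "continuous_map X Y f \<Longrightarrow> continuous_map (dtop_of X) Y f"
  unfolding continuous_map_def topspace_dtop_of openin_dtop_of
  using openin_imp_directed_open[of X] by meson

section \<open>Way-below in continuous spaces\<close>

lemma way_below_mono:
  assumes "spec_le X x' x" "way_below X x y" "spec_le X y y'"
  shows "way_below X x' y'"
  unfolding way_below_def
proof (intro conjI allI impI)
  show "x' \<in> topspace X" "y' \<in> topspace X" using assms by (auto simp: spec_le_def)
  fix D assume "dconv X D y'"
  then have "dconv X D y" using assms(3) by (rule dconv_mono)
  then obtain d where d: "d \<in> D" "spec_le X x d" using assms(2) unfolding way_below_def by blast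
  show "\<exists>d\<in>D. spec_le X x' d" using spec_le_trans[OF assms(1) d(2)] d(1) by blast
qed

lemma way_below_spec_le_trans: "way_below X x y \<Longrightarrow> spec_le X y y' \<Longrightarrow> way_below X x y'"
  by (rule way_below_mono[OF spec_le_refl]) (auto simp: way_below_def)

lemma way_below_imp_spec_le: "way_below X x y \<Longrightarrow> spec_le X x y"
  unfolding way_below_def using dconv_singleton by fastforce

text \<open>The criterion by which all way-below relations in the free algebra are established.\<close>

lemma way_below_openI:
  assumes "openin X U" "y \<in> U" "x \<in> topspace X" "\<And>z. z \<in> U \<Longrightarrow> spec_le X x z"
  shows "way_below X x y"
  using assms openin_subset[OF assms(1)] unfolding way_below_def dconv_def by blast

text \<open>The approximating set provided by continuity is cofinal among all points way below \<open>x\<close>, by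
  the definition of way-below applied to that set.\<close>

lemma continuous_space_dconv:
  assumes "continuous_space X" "x \<in> topspace X"
  shows "dconv X {y. way_below X y x} x"
proof -
  obtain D where D: "D \<subseteq> {y. way_below X y x}" "dconv X D x"
    using assms unfolding continuous_space_def by blast
  have above: "\<exists>d\<in>D. spec_le X y d" if "way_below X y x" for y
    using that D(2) unfolding way_below_def by blast
  show ?thesis
    unfolding dconv_def directed_in_def
  proof (intro conjI ballI allI impI)
    show "{y. way_below X y x} \<subseteq> topspace X" by (auto simp: way_below_def)
    show "{y. way_below X y x} \<noteq> {}" using D by (auto simp: dconv_def directed_in_def)
    show "x \<in> topspace X" by fact
    show "\<exists>c\<in>{y. way_below X y x}. spec_le X a c \<and> spec_le X b c"
      if ab: "a \<in> {y. way_below X y x}" "b \<in> {y. way_below X y x}" for a b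
    proof -
      obtain a' b' where 1: "a' \<in> D" "b' \<in> D" "spec_le X a a'" "spec_le X b b'"
        using ab above by blast
      obtain c where c: "c \<in> D" "spec_le X a' c" "spec_le X b' c"
        using dconv_bound[OF D(2) 1(1,2)] .
      have "spec_le X a c" "spec_le X b c"
        using spec_le_trans[OF 1(3) c(2)] spec_le_trans[OF 1(4) c(3)] .
      then show ?thesis using c(1) D(1) by blast
    qed
    show "{y. way_below X y x} \<inter> U \<noteq> {}" if "openin X U \<and> x \<in> U" for U
      using that D unfolding dconv_def by blast
  qed
qed

text \<open>The points that are two way-below steps below \<open>x\<close> form a directed set converging to \<open>x\<close>; hence
  one of them lies above \<open>y\<close>.\<close>

lemma way_below_interpolate:
  assumes X: "continuous_space X" and yx: "way_below X y x"
  shows "\<exists>w. way_below X y w \<and> way_below X w x"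
proof -
  have x: "x \<in> topspace X" using yx by (simp add: way_below_def)
  let ?D = "{z. \<exists>w. way_below X z w \<and> way_below X w x}"
  have dir: "\<exists>c. way_below X c v \<and> spec_le X a c \<and> spec_le X b c"
    if ab: "way_below X a v" "way_below X b v" for a b v
  proof -
    have "dconv X {y. way_below X y v} v"
      using continuous_space_dconv[OF X] ab(1) by (simp add: way_below_def)
    from dconv_bound[OF this, of a b] ab show ?thesis by blast
  qed
  have ne: "\<exists>z\<in>U. way_below X z v" if "openin X U" "v \<in> U" for U v
    using that continuous_space_dconv[OF X, of v] openin_subset[OF that(1)]
    unfolding dconv_def by blast
  have "dconv X ?D x"
    unfolding dconv_def directed_in_def
  proof (intro conjI ballI allI impI)
    show "?D \<subseteq> topspace X" by (auto simp: way_below_def)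
    show "x \<in> topspace X" by fact
    show meet: "?D \<inter> U \<noteq> {}" if U: "openin X U \<and> x \<in> U" for U
    proof -
      obtain w where w: "w \<in> U" "way_below X w x" using ne[of U x] U by blast
      obtain z where "z \<in> U" "way_below X z w" using ne[of U w] U w(1) by blast
      then show ?thesis using w(2) by blast
    qed
    show "?D \<noteq> {}" using meet[of "topspace X"] x by simp blast
    show "\<exists>c\<in>?D. spec_le X a c \<and> spec_le X b c" if ab: "a \<in> ?D" "b \<in> ?D" for a b
    proof -
      obtain u v where 1: "way_below X a u" "way_below X u x" "way_below X b v" "way_below X v x"
        using ab by blast
      obtain w where w: "way_below X w x" "spec_le X u w" "spec_le X v w"
        using dir 1 by blast
      have "way_below X a w" "way_below X b w"
        using way_below_spec_le_trans[OF 1(1) w(2)] way_below_spec_le_trans[OF 1(3) w(3)] .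
      then show ?thesis using dir w(1) by blast
    qed
  qed
  then obtain z where "z \<in> ?D" "spec_le X y z"
    using yx unfolding way_below_def[of X y x] by blast
  then obtain w where w: "spec_le X y z" "way_below X z w" "way_below X w x" by blast
  have "spec_le X w w" using w(3) by (simp add: way_below_def spec_le_refl)
  then show ?thesis using way_below_mono[OF w(1,2)] w(3) by blast
qed

lemma openin_way_above:
  assumes X: "continuous_space X"
  shows "openin X {x. way_below X y x}"
proof -
  have "directed_open X {x. way_below X y x}"
    unfolding directed_open_def
  proof (intro conjI allI impI)
    show "{x. way_below X y x} \<subseteq> topspace X" by (auto simp: way_below_def)
    fix D x assume D: "dconv X D x \<and> x \<in> {x. way_below X y x}"
    then obtain w where w: "way_below X y w" "way_below X w x"
      using way_below_interpolate[OF X] by blast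
    then obtain d where d: "d \<in> D" "spec_le X w d"
      using D unfolding way_below_def[of X w x] by blast
    then show "D \<inter> {x. way_below X y x} \<noteq> {}"
      using way_below_spec_le_trans[OF w(1) d(2)] by blast
  qed
  then show ?thesis using X by (simp add: continuous_space_def directed_space_def)
qed

section \<open>Powers\<close>

lemma topspace_dtop_power: "topspace (dtop_power A n) = (\<Pi>\<^sub>E j\<in>{..<n}. topspace A)"
  by (simp add: dtop_power_def)

lemma spec_le_dtop_power:
  "spec_le (dtop_power A n) a b \<longleftrightarrow>
    a \<in> topspace (dtop_power A n) \<and> b \<in> topspace (dtop_power A n) \<and> (\<forall>j<n. spec_le A (a j) (b j))"
proof (cases "a \<in> topspace (dtop_power A n) \<and> b \<in> topspace (dtop_power A n)")
  case True
  then have "{b} = (\<Pi>\<^sub>E j\<in>{..<n}. {b j})"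
    using PiE_singleton[of b "{..<n}"] by (auto simp: topspace_dtop_power PiE_iff)
  then have "product_topology (\<lambda>_. A) {..<n} closure_of {b} = (\<Pi>\<^sub>E j\<in>{..<n}. A closure_of {b j})"
    by (simp add: closure_of_product_topology)
  then show ?thesis
    using True by (auto simp: dtop_power_def spec_le_def PiE_iff)
qed (auto simp: spec_le_def)

lemma continuous_map_dtop_power_proj:
  "j < n \<Longrightarrow> continuous_map (dtop_power A n) A (\<lambda>a. a j)"
  unfolding dtop_power_def
  by (intro continuous_map_from_dtop_of continuous_map_product_projection) auto

text \<open>A box of directed sets meets every box of open neighbourhoods, hence every open set of the
  topological product; refining that to the categorical power does not affect convergence.\<close>

lemma dconv_dtop_power:
  assumes D: "\<And>j. j < n \<Longrightarrow> dconv A (D j) (a j)" and a: "a \<in> extensional {..<n}"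
  shows "dconv (dtop_power A n) (\<Pi>\<^sub>E j\<in>{..<n}. D j) a"
proof -
  have Dsub: "D j \<subseteq> topspace A" "D j \<noteq> {}" "a j \<in> topspace A" if "j < n" for j
    using D[OF that] by (auto simp: dconv_def directed_in_def)
  have sub: "(\<Pi>\<^sub>E j\<in>{..<n}. D j) \<subseteq> topspace (dtop_power A n)"
    unfolding topspace_dtop_power using Dsub by (intro PiE_mono) auto
  have "dconv (product_topology (\<lambda>_. A) {..<n}) (\<Pi>\<^sub>E j\<in>{..<n}. D j) a"
    unfolding dconv_def directed_in_def
  proof (intro conjI ballI allI impI)
    show "(\<Pi>\<^sub>E j\<in>{..<n}. D j) \<subseteq> topspace (product_topology (\<lambda>_. A) {..<n})"
      using sub by (simp add: dtop_power_def)
    show "(\<Pi>\<^sub>E j\<in>{..<n}. D j) \<noteq> {}" using Dsub by (simp add: PiE_eq_empty_iff)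
    show "a \<in> topspace (product_topology (\<lambda>_. A) {..<n})"
      using a Dsub by (simp add: PiE_iff)
  next
    fix b c assume bc: "b \<in> (\<Pi>\<^sub>E j\<in>{..<n}. D j)" "c \<in> (\<Pi>\<^sub>E j\<in>{..<n}. D j)"
    have "\<exists>d\<in>D j. spec_le A (b j) d \<and> spec_le A (c j) d" if "j < n" for j
      using dconv_bound[OF D[OF that], of "b j" "c j"] bc that by (metis PiE_mem lessThan_iff)
    then obtain d where d: "\<And>j. j < n \<Longrightarrow> d j \<in> D j \<and> spec_le A (b j) (d j) \<and> spec_le A (c j) (d j)"
      by metis
    let ?d = "restrict d {..<n}"
    have "?d \<in> (\<Pi>\<^sub>E j\<in>{..<n}. D j)" using d by auto
    moreover have "spec_le (dtop_power A n) b ?d" "spec_le (dtop_power A n) c ?d"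
      unfolding spec_le_dtop_power using subsetD[OF sub] bc calculation d by auto
    ultimately show "\<exists>d\<in>\<Pi>\<^sub>E j\<in>{..<n}. D j. spec_le (product_topology (\<lambda>_. A) {..<n}) b d \<and>
        spec_le (product_topology (\<lambda>_. A) {..<n}) c d"
      by (intro bexI[of _ ?d]) (simp_all add: dtop_power_def)
  next
    fix U assume U: "openin (product_topology (\<lambda>_. A) {..<n}) U \<and> a \<in> U"
    then obtain V where V: "\<And>j. j < n \<Longrightarrow> openin A (V j)"
        "a \<in> Pi\<^sub>E {..<n} V" "Pi\<^sub>E {..<n} V \<subseteq> U"
      unfolding openin_product_topology_alt by (metis lessThan_iff)
    have "\<exists>d. d \<in> D j \<inter> V j" if "j < n" for j
      using D[OF that] V(1)[OF that] PiE_mem[OF V(2)] that unfolding dconv_def by blast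
    then obtain d where "\<And>j. j < n \<Longrightarrow> d j \<in> D j \<inter> V j" by metis
    then have "restrict d {..<n} \<in> (\<Pi>\<^sub>E j\<in>{..<n}. D j)" "restrict d {..<n} \<in> Pi\<^sub>E {..<n} V"
      by auto
    then show "(\<Pi>\<^sub>E j\<in>{..<n}. D j) \<inter> U \<noteq> {}" using V(3) by blast
  qed
  then show ?thesis by (simp add: dtop_power_def)
qed

text \<open>From left to right, only one coordinate of \<open>b\<close> is approximated, the others being kept fixed.
  From right to left, finiteness of \<open>n\<close> is essential: one member of the directed set is found for
  each coordinate, and these need a common upper bound.\<close>

lemma way_below_dtop_power:
  assumes a: "a \<in> topspace (dtop_power A n)" and b: "b \<in> topspace (dtop_power A n)"
  shows "way_below (dtop_power A n) a b \<longleftrightarrow> (\<forall>j<n. way_below A (a j) (b j))"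
proof
  assume wb: "way_below (dtop_power A n) a b"
  show "\<forall>j<n. way_below A (a j) (b j)"
    unfolding way_below_def
  proof (intro allI impI conjI)
    fix j assume j: "j < n"
    show "a j \<in> topspace A" "b j \<in> topspace A"
      using a b j by (auto simp: topspace_dtop_power PiE_iff)
    fix D assume D: "dconv A D (b j)"
    let ?D = "\<lambda>k. if k = j then D else {b k}"
    have "dconv (dtop_power A n) (Pi\<^sub>E {..<n} ?D) b"
    proof (rule dconv_dtop_power)
      show "dconv A (?D k) (b k)" if "k < n" for k
        using D that b by (auto simp: topspace_dtop_power PiE_iff intro: dconv_singleton)
      show "b \<in> extensional {..<n}" using b by (auto simp: topspace_dtop_power PiE_iff)
    qed
    then obtain d where d: "d \<in> Pi\<^sub>E {..<n} ?D" "spec_le (dtop_power A n) a d"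
      using wb unfolding way_below_def by blast
    then have "d j \<in> D" "spec_le A (a j) (d j)"
      using j PiE_mem[OF d(1), of j] by (auto simp: spec_le_dtop_power)
    then show "\<exists>d\<in>D. spec_le A (a j) d" by blast
  qed
next
  assume wb: "\<forall>j<n. way_below A (a j) (b j)"
  show "way_below (dtop_power A n) a b"
    unfolding way_below_def
  proof (intro allI impI conjI a b)
    fix D assume D: "dconv (dtop_power A n) D b"
    have "\<exists>d. d \<in> D \<and> spec_le A (a j) (d j)" if j: "j < n" for j
    proof -
      have "dconv A ((\<lambda>d. d j) ` D) (b j)"
        using continuous_map_dconv[OF continuous_map_dtop_power_proj[OF j] D] .
      then show ?thesis using wb j unfolding way_below_def by blast
    qed
    then obtain d where d: "\<And>j. j < n \<Longrightarrow> d j \<in> D \<and> spec_le A (a j) (d j j)" by metis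
    have "directed_in (dtop_power A n) D" using D by (simp add: dconv_def)
    then obtain c where c: "c \<in> D" "\<forall>b\<in>d ` {..<n}. spec_le (dtop_power A n) b c"
      using directed_in_finite_bound[of "dtop_power A n" D "d ` {..<n}"] d by auto
    have "spec_le (dtop_power A n) a c"
      unfolding spec_le_dtop_power
    proof (intro conjI allI impI a)
      show "c \<in> topspace (dtop_power A n)"
        using D c(1) by (auto simp: dconv_def directed_in_def)
      show "spec_le A (a j) (c j)" if "j < n" for j
      proof (rule spec_le_trans)
        show "spec_le A (a j) (d j j)" using d[OF that] by blast
        have "spec_le (dtop_power A n) (d j) c" using c(2) that by blast
        then show "spec_le A (d j j) (c j)" using that by (simp add: spec_le_dtop_power)
      qed
    qed
    then show "\<exists>d\<in>D. spec_le (dtop_power A n) a d" using c(1) by blast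
  qed
qed

lemma continuous_space_dtop_power:
  assumes A: "continuous_space A"
  shows "continuous_space (dtop_power A n)"
  unfolding continuous_space_def
proof (intro conjI ballI)
  have "t0_space A" using A by (simp add: continuous_space_def directed_space_def)
  then show "directed_space (dtop_power A n)"
    unfolding dtop_power_def by (intro directed_space_dtop_of) (simp add: t0_space_product_topology)
next
  fix a assume a: "a \<in> topspace (dtop_power A n)"
  let ?D = "\<Pi>\<^sub>E j\<in>{..<n}. {y. way_below A y (a j)}"
  have conv: "dconv (dtop_power A n) ?D a"
    using a by (intro dconv_dtop_power continuous_space_dconv A)
      (auto simp: topspace_dtop_power PiE_iff)
  then have "?D \<subseteq> topspace (dtop_power A n)" by (simp add: dconv_def directed_in_def)
  then have "?D \<subseteq> {b. way_below (dtop_power A n) b a}"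
    using a by (auto simp: way_below_dtop_power PiE_iff subset_iff)
  then show "\<exists>D\<subseteq>{b. way_below (dtop_power A n) b a}. dconv (dtop_power A n) D a"
    using conv by blast
qed

section \<open>Operations on terms\<close>

text \<open>The operations of the term algebra take their arguments as functions on \<open>{..<ar i}\<close>, as
  the operations of an algebra do. This makes substitution an instance of \<open>term_ext\<close>.\<close>

definition tm_op :: "('i \<Rightarrow> nat) \<Rightarrow> 'i \<Rightarrow> (nat \<Rightarrow> ('i, 'v) trm) \<Rightarrow> ('i, 'v) trm" where
  "tm_op ar i a = Op i (map a [0..<ar i])"

lemma tm_op_eq_iff [simp]:
  "tm_op ar i a = tm_op ar i' b \<longleftrightarrow> i = i' \<and> (\<forall>j<ar i. a j = b j)"
  by (auto simp: tm_op_def)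

lemma tm_op_neq_Var [simp]: "tm_op ar i a \<noteq> Var v" "Var v \<noteq> tm_op ar i a"
  by (auto simp: tm_op_def)

lemma tm_op_wf: "i \<in> I \<Longrightarrow> (\<And>j. j < ar i \<Longrightarrow> a j \<in> wf_terms I ar W) \<Longrightarrow> tm_op ar i a \<in> wf_terms I ar W"
  unfolding tm_op_def by (rule wf_terms.Op) auto

lemma wf_terms_tm_induct [consumes 1, case_names Var tm_op]:
  assumes "t \<in> wf_terms I ar W"
    and "\<And>v. v \<in> W \<Longrightarrow> P (Var v)"
    and "\<And>i a. i \<in> I \<Longrightarrow> (\<And>j. j < ar i \<Longrightarrow> a j \<in> wf_terms I ar W) \<Longrightarrow>
          (\<And>j. j < ar i \<Longrightarrow> P (a j)) \<Longrightarrow> P (tm_op ar i a)"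
  shows "P t"
  using assms(1)
proof induction
  case (Op i ts)
  then have "P (tm_op ar i (nth ts))"
    by (intro assms(3)) auto
  moreover have "tm_op ar i (nth ts) = Op i ts"
    using Op(2) by (simp add: tm_op_def) (metis map_nth)
  ultimately show ?case by simp
qed (rule assms(2))

lemma term_ext_tm_op [simp]:
  "term_ext f h (tm_op ar i a) = f i (\<lambda>j\<in>{..<ar i}. term_ext f h (a j))"
  unfolding tm_op_def by (auto intro!: arg_cong[where f = "f i"])

text \<open>A homomorphism commutes with the evaluation of terms. Substitution, evaluation in an algebra
  and passage to representatives are all treated by this one fact.\<close>

lemma term_ext_hom:
  assumes s: "s \<in> wf_terms I ar W" and h: "\<And>v. v \<in> W \<Longrightarrow> h v \<in> S"
    and clo: "\<And>i a. i \<in> I \<Longrightarrow> a \<in> (\<Pi>\<^sub>E j\<in>{..<ar i}. S) \<Longrightarrow> f i a \<in> S"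
    and hom: "\<And>i a. i \<in> I \<Longrightarrow> a \<in> (\<Pi>\<^sub>E j\<in>{..<ar i}. S) \<Longrightarrow> k (f i a) = g i (\<lambda>j\<in>{..<ar i}. k (a j))"
  shows "term_ext f h s \<in> S \<and> k (term_ext f h s) = term_ext g (\<lambda>v. k (h v)) s"
  using s
proof (induction rule: wf_terms_tm_induct)
  case (tm_op i a)
  let ?b = "\<lambda>j\<in>{..<ar i}. term_ext f h (a j)"
  have "?b \<in> (\<Pi>\<^sub>E j\<in>{..<ar i}. S)" using tm_op by auto
  moreover have "(\<lambda>j\<in>{..<ar i}. k (?b j)) = (\<lambda>j\<in>{..<ar i}. term_ext g (\<lambda>v. k (h v)) (a j))"
    using tm_op by auto
  ultimately show ?case using clo[OF tm_op(1)] hom[OF tm_op(1)] by simp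
qed (simp add: h)

lemma universal_arrowD:
  fixes B :: "'b topology"
  assumes "universal_arrow TYPE('b) I ar E X A f \<eta>" "DTop_obj I ar E B g" "continuous_map X B k"
  shows "\<exists>!k'. k' \<in> extensional (topspace A) \<and> dtop_hom I ar A f B g k' \<and>
               (\<forall>x\<in>topspace X. k' (\<eta> x) = k x)"
  using assms(1)[unfolded universal_arrow_def, rule_format, OF conjI[OF assms(2,3)]] .

lemma dtop_hom_id: "dtop_hom I ar A f A f (\<lambda>a. a)"
  by (simp add: dtop_hom_def topspace_dtop_power PiE_iff extensional_restrict)

lemma dtop_hom_compose:
  assumes k: "dtop_hom I ar A f B g k" and k': "dtop_hom I ar B g C h k'"
  shows "dtop_hom I ar A f C h (\<lambda>a. k' (k a))"
  unfolding dtop_hom_def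
proof (intro conjI ballI)
  have c: "continuous_map A B k" "continuous_map B C k'" using k k' by (auto simp: dtop_hom_def)
  then show "continuous_map A C (\<lambda>a. k' (k a))" using continuous_map_compose[OF c] by (simp add: o_def)
  fix i a assume ia: "i \<in> I" "a \<in> topspace (dtop_power A (ar i))"
  let ?b = "\<lambda>j\<in>{..<ar i}. k (a j)"
  have "?b \<in> topspace (dtop_power B (ar i))"
    using ia(2) c(1) by (auto simp: topspace_dtop_power PiE_iff continuous_map_def)
  then have "k' (g i ?b) = h i (\<lambda>j\<in>{..<ar i}. k' (?b j))"
    using k' ia(1) unfolding dtop_hom_def by blast
  moreover have "k (f i a) = g i ?b" using k ia unfolding dtop_hom_def by blast
  ultimately show "k' (k (f i a)) = h i (\<lambda>j\<in>{..<ar i}. k' (k (a j)))"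
    by (simp cong: restrict_cong)
qed

lemma dtop_hom_restrict:
  assumes A: "dtop_algebra I ar A f" and k: "dtop_hom I ar A f B g k"
  shows "dtop_hom I ar A f B g (restrict k (topspace A))"
  unfolding dtop_hom_def
proof (intro conjI ballI)
  show "continuous_map A B (restrict k (topspace A))"
    using k by (auto simp: dtop_hom_def intro: continuous_map_eq)
  fix i a assume ia: "i \<in> I" "a \<in> topspace (dtop_power A (ar i))"
  have "f i a \<in> topspace A"
    using A ia by (auto simp: dtop_algebra_def continuous_map_def)
  moreover have "(\<lambda>j\<in>{..<ar i}. restrict k (topspace A) (a j)) = (\<lambda>j\<in>{..<ar i}. k (a j))"
    using ia(2) by (intro restrict_ext) (simp add: topspace_dtop_power PiE_iff)
  ultimately show "restrict k (topspace A) (f i a) = g i (\<lambda>j\<in>{..<ar i}. restrict k (topspace A) (a j))"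
    using k ia by (simp add: dtop_hom_def)
qed

lemma term_ext_Var: "t \<in> wf_terms I ar W \<Longrightarrow> term_ext (tm_op ar) Var t = t"
  by (induction rule: wf_terms_tm_induct) auto

section \<open>Way-below and inequality between terms\<close>

locale terms_over_continuous_space =
  fixes I :: "'i set" and ar :: "'i \<Rightarrow> nat"
    and E :: "(('i, 'v) trm \<times> ('i, 'v) trm) set"
    and X :: "'x topology"
  assumes ineqs_wf: "E \<subseteq> wf_terms I ar UNIV \<times> wf_terms I ar UNIV"
    and cont_X: "continuous_space X"
begin

abbreviation T :: "('i, 'x) trm set" where
  "T \<equiv> wf_terms I ar (topspace X)"

abbreviation subst :: "('v \<Rightarrow> ('i, 'x) trm) \<Rightarrow> ('i, 'v) trm \<Rightarrow> ('i, 'x) trm" where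
  "subst h s \<equiv> term_ext (tm_op ar) h s"

inductive tm_wb :: "('i, 'x) trm \<Rightarrow> ('i, 'x) trm \<Rightarrow> bool" where
  Var: "way_below X y x \<Longrightarrow> tm_wb (Var y) (Var x)"
| Op: "i \<in> I \<Longrightarrow> (\<And>j. j < ar i \<Longrightarrow> tm_wb (a j) (b j)) \<Longrightarrow> tm_wb (tm_op ar i a) (tm_op ar i b)"

inductive tm_le :: "('i, 'x) trm \<Rightarrow> ('i, 'x) trm \<Rightarrow> bool" where
  refl: "t \<in> T \<Longrightarrow> tm_le t t"
| trans: "tm_le s t \<Longrightarrow> tm_le t u \<Longrightarrow> tm_le s u"
| Var: "spec_le X x y \<Longrightarrow> tm_le (Var x) (Var y)"
| Op: "i \<in> I \<Longrightarrow> (\<And>j. j < ar i \<Longrightarrow> tm_le (a j) (b j)) \<Longrightarrow> tm_le (tm_op ar i a) (tm_op ar i b)"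
| ineq: "(s, t) \<in> E \<Longrightarrow> (\<And>v. h v \<in> T) \<Longrightarrow> tm_le (subst h s) (subst h t)"

lemma subst_wf: "s \<in> wf_terms I ar UNIV \<Longrightarrow> (\<And>v. h v \<in> T) \<Longrightarrow> subst h s \<in> T"
  by (induction rule: wf_terms_tm_induct) (auto intro: tm_op_wf)

lemma tm_le_wf: "tm_le s t \<Longrightarrow> s \<in> T \<and> t \<in> T"
proof (induction rule: tm_le.induct)
  case (ineq s t h)
  then show ?case using ineqs_wf by (auto intro!: subst_wf)
qed (auto intro: wf_terms.Var tm_op_wf simp: spec_le_def)

lemma tm_wb_wf: "tm_wb s t \<Longrightarrow> s \<in> T \<and> t \<in> T"
  by (induction rule: tm_wb.induct) (auto intro: wf_terms.Var tm_op_wf simp: way_below_def)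

lemma tm_wb_imp_le: "tm_wb s t \<Longrightarrow> tm_le s t"
  by (induction rule: tm_wb.induct) (auto intro: tm_le.Var tm_le.Op way_below_imp_spec_le)

lemma tm_wb_VarE:
  assumes "tm_wb s (Var x)"
  obtains y where "s = Var y" "way_below X y x"
  using assms by cases auto

lemma tm_wb_opE:
  assumes "tm_wb s (tm_op ar i b)"
  obtains a where "s = tm_op ar i a" "i \<in> I" "\<And>j. j < ar i \<Longrightarrow> tm_wb (a j) (b j)"
  using assms by cases auto

lemma tm_wb_interpolate: "tm_wb s t \<Longrightarrow> \<exists>m. tm_wb s m \<and> tm_wb m t"
proof (induction rule: tm_wb.induct)
  case (Var y x)
  then show ?case using way_below_interpolate[OF cont_X] tm_wb.Var by metis
next
  case (Op i a b)
  then obtain m where "\<And>j. j < ar i \<Longrightarrow> tm_wb (a j) (m j) \<and> tm_wb (m j) (b j)" by metis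
  then show ?case using tm_wb.Op[OF Op(1)] by (intro exI[of _ "tm_op ar i m"]) auto
qed

lemma tm_wb_nonempty: "t \<in> T \<Longrightarrow> \<exists>s. tm_wb s t"
proof (induction rule: wf_terms_tm_induct)
  case (Var x)
  then have "{y. way_below X y x} \<noteq> {}"
    using continuous_space_dconv[OF cont_X] by (auto simp: dconv_def directed_in_def)
  then show ?case by (auto intro: tm_wb.Var)
next
  case (tm_op i b)
  then obtain a where "\<And>j. j < ar i \<Longrightarrow> tm_wb (a j) (b j)" by metis
  then show ?case using tm_wb.Op[OF tm_op(1)] by blast
qed

lemma tm_wb_bound:
  assumes "tm_wb s t" "tm_wb s' t"
  shows "\<exists>m. tm_wb m t \<and> tm_le s m \<and> tm_le s' m"
  using assms
proof (induction arbitrary: s' rule: tm_wb.induct)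
  case (Var y x)
  from Var(2) obtain y' where y': "s' = Var y'" "way_below X y' x" by (rule tm_wb_VarE)
  have "dconv X {y. way_below X y x} x"
    using Var by (intro continuous_space_dconv cont_X) (simp add: way_below_def)
  from dconv_bound[OF this, of y y'] Var(1) y'(2)
  obtain z where "way_below X z x" "spec_le X y z" "spec_le X y' z" by blast
  then show ?case using y'(1) tm_wb.Var tm_le.Var by blast
next
  case (Op i a b)
  from Op.prems obtain a' where a': "s' = tm_op ar i a'" "\<And>j. j < ar i \<Longrightarrow> tm_wb (a' j) (b j)"
    by (rule tm_wb_opE) blast
  have "\<exists>m. tm_wb m (b j) \<and> tm_le (a j) m \<and> tm_le (a' j) m" if "j < ar i" for j
    using Op.IH[OF that a'(2)[OF that]] .
  then obtain m where m: "\<And>j. j < ar i \<Longrightarrow> tm_wb (m j) (b j) \<and> tm_le (a j) (m j) \<and> tm_le (a' j) (m j)"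
    by metis
  show ?case unfolding a'(1)
    using m Op(1) by (intro exI[of _ "tm_op ar i m"]) (auto intro!: tm_wb.Op tm_le.Op)
qed

lemma tm_wb_finite_bound:
  assumes "t \<in> T" "finite F" "\<And>s. s \<in> F \<Longrightarrow> tm_wb s t"
  shows "\<exists>m. tm_wb m t \<and> (\<forall>s\<in>F. tm_le s m)"
  using assms(2,3)
proof (induction F)
  case empty
  then show ?case using tm_wb_nonempty[OF assms(1)] by simp
next
  case (insert s F)
  then obtain m where m: "tm_wb m t" "\<forall>s\<in>F. tm_le s m" by blast
  obtain m' where "tm_wb m' t" "tm_le s m'" "tm_le m m'"
    using tm_wb_bound[OF insert.prems m(1)] by blast
  then show ?case using m(2) tm_le.trans by blast
qed

text \<open>The occurrences of a variable \<open>v\<close> in \<open>s\<close> give rise to several approximations of \<open>h v\<close> inside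
  \<open>r\<close>, so \<open>r\<close> need not be a substitution instance of \<open>s\<close>. It lies below one as soon as a single
  approximation \<open>h0 v\<close> dominates them all. The claim is made for every \<open>h'\<close> above \<open>h0\<close>, so
  that in the induction the assignments found for the arguments can be merged.\<close>

lemma tm_wb_subst_le:
  assumes "s \<in> wf_terms I ar UNIV" "\<And>v. h v \<in> T" "tm_wb r (subst h s)"
  shows "\<exists>h0. (\<forall>v. tm_wb (h0 v) (h v)) \<and> (\<forall>h'. (\<forall>v. tm_le (h0 v) (h' v)) \<longrightarrow> tm_le r (subst h' s))"
  using assms(1,3)
proof (induction arbitrary: r rule: wf_terms_tm_induct)
  case (Var v)
  obtain k where k: "\<And>w. tm_wb (k w) (h w)" using tm_wb_nonempty[OF assms(2)] by metis
  show ?case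
    (* Variables other than v need some approximation as well, whichever it is. *)
    using Var k by (intro exI[of _ "k(v := r)"]) (auto split: if_splits)
next
  case (tm_op i a)
  have "tm_wb r (tm_op ar i (\<lambda>j\<in>{..<ar i}. subst h (a j)))" using tm_op.prems by simp
  then obtain q where q: "r = tm_op ar i q"
      "\<And>j. j < ar i \<Longrightarrow> tm_wb (q j) ((\<lambda>j\<in>{..<ar i}. subst h (a j)) j)"
    by (rule tm_wb_opE) blast
  have "\<exists>h0. (\<forall>v. tm_wb (h0 v) (h v)) \<and> (\<forall>h'. (\<forall>v. tm_le (h0 v) (h' v)) \<longrightarrow> tm_le (q j) (subst h' (a j)))"
    if "j < ar i" for j
    using tm_op.IH[OF that, of "q j"] q(2)[OF that] that by simp
  then obtain k where k: "\<And>j v. j < ar i \<Longrightarrow> tm_wb (k j v) (h v)"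
      "\<And>j h'. j < ar i \<Longrightarrow> (\<forall>v. tm_le (k j v) (h' v)) \<Longrightarrow> tm_le (q j) (subst h' (a j))"
    by metis
  have "\<exists>m. tm_wb m (h v) \<and> (\<forall>s\<in>(\<lambda>j. k j v) ` {..<ar i}. tm_le s m)" for v
    using k(1) by (intro tm_wb_finite_bound assms(2)) auto
  then obtain h0 where h0: "\<And>v. tm_wb (h0 v) (h v)" "\<And>v j. j < ar i \<Longrightarrow> tm_le (k j v) (h0 v)"
    by (metis image_eqI lessThan_iff)
  show ?case
  proof (intro exI[of _ h0] conjI allI impI h0(1))
    fix h' assume h': "\<forall>v. tm_le (h0 v) (h' v)"
    have "tm_le (q j) (subst h' (a j))" if "j < ar i" for j
      using k(2)[OF that] h0(2)[OF that] h' tm_le.trans by blast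
    then show "tm_le r (subst h' (tm_op ar i a))"
      unfolding q(1) term_ext_tm_op using tm_op(1) by (intro tm_le.Op) auto
  qed
qed

lemma tm_wb_subst:
  assumes "s \<in> wf_terms I ar UNIV" "\<And>v. tm_wb (h0 v) (h v)"
  shows "tm_wb (subst h0 s) (subst h s)"
  using assms(1)
  by (induction rule: wf_terms_tm_induct) (auto simp: assms(2) intro!: tm_wb.Op)

text \<open>Replacing an inequality's left side by its right side does not destroy approximations. This
  is what makes \<open>tm_above s\<close> an upper set for \<open>tm_le\<close>.\<close>

lemma tm_wb_le_trans:
  assumes "tm_le t u" "tm_wb s t"
  shows "\<exists>m. tm_wb m u \<and> tm_le s m"
  using assms
proof (induction arbitrary: s rule: tm_le.induct)
  case (refl t)
  then show ?case using tm_wb_wf tm_le.refl by blast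
next
  case (trans r t u)
  then show ?case using tm_le.trans by meson
next
  case (Var x y)
  from Var(2) obtain z where z: "s = Var z" "way_below X z x" by (rule tm_wb_VarE)
  then have "tm_wb (Var z) (Var y)" using way_below_spec_le_trans Var(1) tm_wb.Var by metis
  then show ?case using z(1) tm_wb_wf tm_le.refl by blast
next
  case (Op i a b)
  from Op.prems obtain q where q: "s = tm_op ar i q" "\<And>j. j < ar i \<Longrightarrow> tm_wb (q j) (a j)"
    by (rule tm_wb_opE) blast
  have "\<exists>m. tm_wb m (b j) \<and> tm_le (q j) m" if "j < ar i" for j
    using Op.IH[OF that q(2)[OF that]] .
  then obtain m where m: "\<And>j. j < ar i \<Longrightarrow> tm_wb (m j) (b j) \<and> tm_le (q j) (m j)" by metis
  show ?case unfolding q(1)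
    using m Op(1) by (intro exI[of _ "tm_op ar i m"]) (auto intro!: tm_wb.Op tm_le.Op)
next
  case (ineq r t h)
  have wf: "r \<in> wf_terms I ar UNIV" "t \<in> wf_terms I ar UNIV" using ineqs_wf ineq(1) by auto
  obtain h0 where h0: "\<And>v. tm_wb (h0 v) (h v)"
      "\<And>h'. (\<forall>v. tm_le (h0 v) (h' v)) \<Longrightarrow> tm_le s (subst h' r)"
    using tm_wb_subst_le[OF wf(1) ineq(2,3)] by blast
  have h0T: "h0 v \<in> T" for v using h0(1) tm_wb_wf by blast
  have "tm_le s (subst h0 r)" using h0(2) h0T tm_le.refl by blast
  moreover have "tm_le (subst h0 r) (subst h0 t)" using ineq(1) h0T by (rule tm_le.ineq)
  moreover have "tm_wb (subst h0 t) (subst h t)" using wf(2) h0(1) by (rule tm_wb_subst)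
  ultimately show ?case using tm_le.trans by blast
qed

section \<open>The space of terms\<close>

text \<open>The second condition is roundedness. Because \<open>X\<close> is continuous, it expresses that membership
  depends continuously on the leaves of a term, without mentioning contexts.\<close>

definition tm_open :: "('i, 'x) trm set \<Rightarrow> bool" where
  "tm_open U \<longleftrightarrow> U \<subseteq> T \<and> (\<forall>t u. tm_le t u \<longrightarrow> t \<in> U \<longrightarrow> u \<in> U) \<and> (\<forall>t\<in>U. \<exists>s\<in>U. tm_wb s t)"

definition tm_space :: "('i, 'x) trm topology" where
  "tm_space = topology tm_open"

lemma istopology_tm_open: "istopology tm_open"
  unfolding istopology_def
proof (intro conjI allI impI)
  fix U V assume UV: "tm_open U" "tm_open V"
  show "tm_open (U \<inter> V)"
    unfolding tm_open_def
  proof (intro conjI allI impI ballI)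
    show "U \<inter> V \<subseteq> T" using UV by (auto simp: tm_open_def)
    show "u \<in> U \<inter> V" if "tm_le t u" "t \<in> U \<inter> V" for t u
      using UV that unfolding tm_open_def by blast
    fix t assume "t \<in> U \<inter> V"
    then obtain r s where rs: "r \<in> U" "tm_wb r t" "s \<in> V" "tm_wb s t"
      using UV unfolding tm_open_def by blast
    then obtain m where m: "tm_wb m t" "tm_le r m" "tm_le s m" using tm_wb_bound by blast
    have "m \<in> U \<inter> V" using UV rs m unfolding tm_open_def by blast
    then show "\<exists>s\<in>U \<inter> V. tm_wb s t" using m(1) by blast
  qed
next
  fix K assume K: "\<forall>U\<in>K. tm_open U"
  show "tm_open (\<Union>K)"
    unfolding tm_open_def
  proof (intro conjI allI impI ballI)
    show "\<Union>K \<subseteq> T" using K by (auto simp: tm_open_def)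
    show "u \<in> \<Union>K" if "tm_le t u" "t \<in> \<Union>K" for t u
      using K that unfolding tm_open_def by blast
    show "\<exists>s\<in>\<Union>K. tm_wb s t" if "t \<in> \<Union>K" for t
      using K that unfolding tm_open_def by blast
  qed
qed

lemma openin_tm_space [simp]: "openin tm_space U \<longleftrightarrow> tm_open U"
  by (simp add: tm_space_def istopology_tm_open topology_inverse')

lemma tm_open_T: "tm_open T"
  unfolding tm_open_def using tm_le_wf tm_wb_wf tm_wb_nonempty by blast

lemma topspace_tm_space [simp]: "topspace tm_space = T"
proof
  have "tm_open (topspace tm_space)" using openin_topspace openin_tm_space by blast
  then show "topspace tm_space \<subseteq> T" by (simp add: tm_open_def)
  show "T \<subseteq> topspace tm_space" using tm_open_T by (intro openin_subset) simp
qed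

definition tm_above :: "('i, 'x) trm \<Rightarrow> ('i, 'x) trm set" where
  "tm_above t = {u. \<exists>s. tm_wb s u \<and> tm_le t s}"

lemma tm_open_above: "tm_open (tm_above t)"
  unfolding tm_open_def
proof (intro conjI allI impI ballI)
  show "tm_above t \<subseteq> T" using tm_wb_wf by (auto simp: tm_above_def)
  show "u \<in> tm_above t" if tu: "tm_le r u" "r \<in> tm_above t" for r u
  proof -
    obtain s where s: "tm_wb s r" "tm_le t s" using tu(2) by (auto simp: tm_above_def)
    then obtain m where "tm_wb m u" "tm_le s m" using tm_wb_le_trans[OF tu(1)] by blast
    then show ?thesis using s(2) tm_le.trans by (auto simp: tm_above_def)
  qed
  fix u assume "u \<in> tm_above t"
  then obtain s where s: "tm_wb s u" "tm_le t s" by (auto simp: tm_above_def)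
  then obtain m where "tm_wb s m" "tm_wb m u" using tm_wb_interpolate by blast
  then show "\<exists>m\<in>tm_above t. tm_wb m u" using s(2) by (auto simp: tm_above_def)
qed

lemma tm_above_wb: "tm_wb s t \<Longrightarrow> t \<in> tm_above s"
  unfolding tm_above_def using tm_le.refl tm_wb_wf by blast

lemma tm_above_imp_le: "u \<in> tm_above t \<Longrightarrow> tm_le t u"
  unfolding tm_above_def using tm_wb_imp_le tm_le.trans by blast

text \<open>The operations are continuous even for the topological product: an approximation of
  \<open>tm_op ar i a\<close> inside \<open>U\<close> is given by approximations \<open>c j\<close> of the arguments, and the sets
  \<open>tm_above (c j)\<close> serve as neighbourhoods.\<close>

lemma tm_op_open:
  assumes U: "tm_open U" and i: "i \<in> I" and a: "tm_op ar i a \<in> U"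
  shows "\<exists>V. (\<forall>j<ar i. tm_open (V j) \<and> a j \<in> V j) \<and>
    (\<forall>b. (\<forall>j<ar i. b j \<in> V j) \<longrightarrow> tm_op ar i b \<in> U)"
proof -
  obtain s where "s \<in> U" "tm_wb s (tm_op ar i a)" using U a by (auto simp: tm_open_def)
  then obtain c where c: "tm_op ar i c \<in> U" "\<And>j. j < ar i \<Longrightarrow> tm_wb (c j) (a j)"
    using tm_wb_opE by metis
  have "tm_op ar i b \<in> U" if "\<forall>j<ar i. b j \<in> tm_above (c j)" for b
  proof -
    have "tm_le (tm_op ar i c) (tm_op ar i b)"
      using i that tm_above_imp_le by (intro tm_le.Op) auto
    then show ?thesis using U c(1) unfolding tm_open_def by blast
  qed
  then show ?thesis
    using c(2) tm_open_above tm_above_wb by (intro exI[of _ "\<lambda>j. tm_above (c j)"]) blast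
qed

section \<open>The algebra of representatives\<close>

definition same_opens :: "('i, 'x) trm \<Rightarrow> ('i, 'x) trm \<Rightarrow> bool" where
  "same_opens t u \<longleftrightarrow> (\<forall>U. tm_open U \<longrightarrow> t \<in> U \<longleftrightarrow> u \<in> U)"

text \<open>The universal property is available for algebras carried by the type of terms, so the \<open>T\<^sub>0\<close>
  reflection is built from chosen terms and not from equivalence classes. As every open set is a
  union of classes, the subspace of representatives is homeomorphic to the quotient.\<close>

definition rep :: "('i, 'x) trm \<Rightarrow> ('i, 'x) trm" where
  "rep t = (SOME u. same_opens t u)"

lemma rep_open: "tm_open U \<Longrightarrow> rep t \<in> U \<longleftrightarrow> t \<in> U"
proof -
  have "same_opens t (rep t)"
    unfolding rep_def by (rule someI[of _ t]) (simp add: same_opens_def)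
  then show "tm_open U \<Longrightarrow> rep t \<in> U \<longleftrightarrow> t \<in> U" by (simp add: same_opens_def)
qed

lemma rep_wf [simp]: "rep t \<in> T \<longleftrightarrow> t \<in> T"
  using rep_open[OF tm_open_T] .

lemma rep_eqI: "(\<And>U. tm_open U \<Longrightarrow> t \<in> U \<longleftrightarrow> u \<in> U) \<Longrightarrow> rep t = rep u"
  unfolding rep_def same_opens_def by simp

lemma rep_rep [simp]: "rep (rep t) = rep t"
  by (rule rep_eqI) (rule rep_open)

definition tm_alg :: "('i, 'x) trm topology" where
  "tm_alg = subtopology tm_space (rep ` T)"

definition alg_op :: "'i \<Rightarrow> (nat \<Rightarrow> ('i, 'x) trm) \<Rightarrow> ('i, 'x) trm" where
  "alg_op i a = rep (tm_op ar i a)"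

lemma topspace_tm_alg [simp]: "topspace tm_alg = rep ` T"
  by (auto simp: tm_alg_def)

lemma openin_tm_alg: "openin tm_alg W \<longleftrightarrow> (\<exists>U. tm_open U \<and> W = U \<inter> rep ` T)"
  by (simp add: tm_alg_def openin_subtopology)

lemma rep_image_wf: "t \<in> rep ` T \<Longrightarrow> t \<in> T"
  by auto

lemma tm_le_spec_le:
  assumes "tm_le t u"
  shows "spec_le tm_alg (rep t) (rep u)"
  unfolding spec_le_iff openin_tm_alg
proof (intro conjI allI impI)
  show "rep t \<in> topspace tm_alg" "rep u \<in> topspace tm_alg" using tm_le_wf[OF assms] by auto
  fix W assume "\<exists>U. tm_open U \<and> W = U \<inter> rep ` T" "rep t \<in> W"
  then obtain U where U: "tm_open U" "W = U \<inter> rep ` T" "t \<in> U" using rep_open by auto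
  then have "u \<in> U" using assms unfolding tm_open_def by blast
  then show "rep u \<in> W" using U rep_open tm_le_wf[OF assms] by auto
qed

text \<open>Roundedness of open sets, read as convergence of the approximations of a term.\<close>

lemma dconv_rep:
  assumes "t \<in> T"
  shows "dconv tm_alg (rep ` {s. tm_wb s t}) (rep t)"
  unfolding dconv_def directed_in_def
proof (intro conjI ballI allI impI)
  show "rep ` {s. tm_wb s t} \<subseteq> topspace tm_alg" using tm_wb_wf by auto
  show "rep ` {s. tm_wb s t} \<noteq> {}" using tm_wb_nonempty[OF assms] by simp
  show "rep t \<in> topspace tm_alg" using assms by simp
  fix r s assume "r \<in> rep ` {s. tm_wb s t}" "s \<in> rep ` {s. tm_wb s t}"
  then obtain r' s' where rs: "r = rep r'" "s = rep s'" "tm_wb r' t" "tm_wb s' t" by blast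
  then obtain m where "tm_wb m t" "tm_le r' m" "tm_le s' m" using tm_wb_bound by blast
  then show "\<exists>c\<in>rep ` {s. tm_wb s t}. spec_le tm_alg r c \<and> spec_le tm_alg s c"
    unfolding rs using tm_le_spec_le by blast
next
  fix W assume "openin tm_alg W \<and> rep t \<in> W"
  then obtain U where U: "tm_open U" "W = U \<inter> rep ` T" "t \<in> U"
    using rep_open by (auto simp: openin_tm_alg)
  then obtain s where "s \<in> U" "tm_wb s t" by (auto simp: tm_open_def)
  then show "rep ` {s. tm_wb s t} \<inter> W \<noteq> {}" using U rep_open tm_wb_wf by fast
qed

text \<open>The preimage of a directed-open set under \<open>rep\<close> is a \<open>tm_le\<close>-upper set because directed-open
  sets are upper sets, and it is rounded because the approximations of a term converge to it.\<close>

lemma directed_space_tm_alg: "directed_space tm_alg"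
  unfolding directed_space_def
proof (intro conjI allI impI)
  show "t0_space tm_alg"
    unfolding t0_space_def topspace_tm_alg
  proof (intro ballI impI)
    fix t u assume tu: "t \<in> rep ` T" "u \<in> rep ` T" "t \<noteq> u"
    then have "rep t \<noteq> rep u" by auto
    then obtain U where "tm_open U" "(t \<in> U) \<noteq> (u \<in> U)" using rep_eqI by blast
    then show "\<exists>U. openin tm_alg U \<and> (t \<notin> U) = (u \<in> U)"
      using tu by (intro exI[of _ "U \<inter> rep ` T"]) (auto simp: openin_tm_alg)
  qed
  fix W assume W: "directed_open tm_alg W"
  let ?U = "{t \<in> T. rep t \<in> W}"
  have "tm_open ?U"
    unfolding tm_open_def
  proof (intro conjI allI impI ballI)
    show "?U \<subseteq> T" by auto
    show "u \<in> ?U" if "tm_le t u" "t \<in> ?U" for t u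
      using that tm_le_wf directed_open_upper[OF W _ tm_le_spec_le] by blast
    fix t assume t: "t \<in> ?U"
    then have "rep ` {s. tm_wb s t} \<inter> W \<noteq> {}"
      using W dconv_rep unfolding directed_open_def by blast
    then show "\<exists>s\<in>?U. tm_wb s t" using tm_wb_wf by blast
  qed
  moreover have "W = ?U \<inter> rep ` T"
    using W unfolding directed_open_def topspace_tm_alg by force
  ultimately show "openin tm_alg W" unfolding openin_tm_alg by blast
qed

text \<open>Terms with the same neighbourhoods have the same neighbourhoods after an operation has been
  applied, by continuity (\<open>tm_op_open\<close>); so the operations descend to the reflection.\<close>

lemma alg_op_rep:
  assumes i: "i \<in> I"
  shows "alg_op i (\<lambda>j\<in>{..<ar i}. rep (a j)) = rep (tm_op ar i a)"
  unfolding alg_op_def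
proof (rule rep_eqI)
  fix U assume U: "tm_open U"
  let ?b = "\<lambda>j\<in>{..<ar i}. rep (a j)"
  show "tm_op ar i ?b \<in> U \<longleftrightarrow> tm_op ar i a \<in> U"
  proof
    assume "tm_op ar i ?b \<in> U"
    then obtain V where V: "\<forall>j<ar i. tm_open (V j) \<and> ?b j \<in> V j"
        "\<And>c. (\<forall>j<ar i. c j \<in> V j) \<Longrightarrow> tm_op ar i c \<in> U"
      using tm_op_open[OF U i] by metis
    show "tm_op ar i a \<in> U" using V(1) rep_open by (intro V(2)) auto
  next
    assume "tm_op ar i a \<in> U"
    then obtain V where V: "\<forall>j<ar i. tm_open (V j) \<and> a j \<in> V j"
        "\<And>c. (\<forall>j<ar i. c j \<in> V j) \<Longrightarrow> tm_op ar i c \<in> U"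
      using tm_op_open[OF U i] by metis
    show "tm_op ar i ?b \<in> U" using V(1) rep_open by (intro V(2)) auto
  qed
qed

lemma continuous_map_alg_op:
  assumes i: "i \<in> I"
  shows "continuous_map (dtop_power tm_alg (ar i)) tm_alg (alg_op i)"
  unfolding dtop_power_def
proof (rule continuous_map_from_dtop_of)
  let ?P = "product_topology (\<lambda>_. tm_alg) {..<ar i}"
  have wf: "tm_op ar i a \<in> T" if "a \<in> topspace ?P" for a
    using that i by (intro tm_op_wf rep_image_wf) (simp_all add: PiE_iff)
  show "continuous_map ?P tm_alg (alg_op i)"
    unfolding continuous_map_def
  proof (intro conjI allI impI)
    show "alg_op i \<in> topspace ?P \<rightarrow> topspace tm_alg"
      using wf by (auto simp: alg_op_def simp del: topspace_product_topology)
    fix W assume "openin tm_alg W"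
    then obtain U where U: "tm_open U" "W = U \<inter> rep ` T" by (auto simp: openin_tm_alg)
    show "openin ?P {a \<in> topspace ?P. alg_op i a \<in> W}"
    proof (subst openin_subopen, intro ballI)
      fix a assume "a \<in> {a \<in> topspace ?P. alg_op i a \<in> W}"
      then have a: "a \<in> topspace ?P" "tm_op ar i a \<in> U"
        using U rep_open by (auto simp: alg_op_def)
      then obtain V where V: "\<forall>j<ar i. tm_open (V j) \<and> a j \<in> V j"
          "\<And>c. (\<forall>j<ar i. c j \<in> V j) \<Longrightarrow> tm_op ar i c \<in> U"
        using tm_op_open[OF U(1) i] by metis
      let ?N = "\<Pi>\<^sub>E j\<in>{..<ar i}. V j \<inter> rep ` T"
      have "openin ?P ?N"
        using V(1) by (subst openin_PiE) (auto simp: openin_tm_alg)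
      moreover have "a \<in> ?N" using a(1) V(1) by (auto simp: PiE_iff)
      moreover have "c \<in> topspace ?P" "alg_op i c \<in> W" if "c \<in> ?N" for c
      proof -
        show c: "c \<in> topspace ?P" using that by (auto simp: PiE_iff)
        have "tm_op ar i c \<in> U" using that by (intro V(2)) (auto simp: PiE_iff)
        then show "alg_op i c \<in> W" using U rep_open wf[OF c] by (auto simp: alg_op_def)
      qed
      ultimately show "\<exists>N. openin ?P N \<and> a \<in> N \<and> N \<subseteq> {a \<in> topspace ?P. alg_op i a \<in> W}"
        by blast
    qed
  qed
qed

lemma rep_term_ext:
  assumes "s \<in> wf_terms I ar W" "\<And>v. v \<in> W \<Longrightarrow> h v \<in> T"
  shows "rep (term_ext (tm_op ar) h s) = term_ext alg_op (\<lambda>v. rep (h v)) s"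
proof -
  have "term_ext (tm_op ar) h s \<in> T \<and>
    rep (term_ext (tm_op ar) h s) = term_ext alg_op (\<lambda>v. rep (h v)) s"
    using assms
    by (rule term_ext_hom) (auto simp: alg_op_rep intro!: tm_op_wf)
  then show ?thesis ..
qed

lemma DTop_obj_tm_alg: "DTop_obj I ar E tm_alg alg_op"
  unfolding DTop_obj_def dtop_algebra_def
proof (intro conjI ballI directed_space_tm_alg continuous_map_alg_op)
  show "satisfies_ineqs E tm_alg alg_op"
    unfolding satisfies_ineqs_def
  proof (intro ballI, clarify)
    fix s t and h :: "'v \<Rightarrow> ('i, 'x) trm"
    assume st: "(s, t) \<in> E" and "h \<in> UNIV \<rightarrow> topspace tm_alg"
    then have h: "h v \<in> rep ` T" for v by (simp add: Pi_iff)
    have hT: "h v \<in> T" for v using h[of v] by auto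
    have "rep (h v) = h v" for v using h[of v] by auto
    moreover have "s \<in> wf_terms I ar UNIV" "t \<in> wf_terms I ar UNIV" using ineqs_wf st by auto
    moreover have "spec_le tm_alg (rep (subst h s)) (rep (subst h t))"
      using st hT by (intro tm_le_spec_le tm_le.ineq)
    ultimately show "spec_le tm_alg (term_ext alg_op h s) (term_ext alg_op h t)"
      using rep_term_ext[of _ UNIV h] hT by simp
  qed
qed

text \<open>By roundedness, the preimage of an open set is a union of sets \<open>{x. way_below X y x}\<close>, which
  are open as \<open>X\<close> is continuous.\<close>

lemma continuous_map_rep_Var: "continuous_map X tm_alg (\<lambda>x. rep (Var x))"
  unfolding continuous_map_def
proof (intro conjI allI impI)
  show "(\<lambda>x. rep (Var x)) \<in> topspace X \<rightarrow> topspace tm_alg" by (auto intro: wf_terms.Var)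
  fix W assume "openin tm_alg W"
  then obtain U where U: "tm_open U" "W = U \<inter> rep ` T" by (auto simp: openin_tm_alg)
  have "{x \<in> topspace X. rep (Var x) \<in> W} = (\<Union>y\<in>{y. Var y \<in> U}. {x. way_below X y x})"
  proof (intro equalityI subsetI)
    fix x assume "x \<in> {x \<in> topspace X. rep (Var x) \<in> W}"
    then have "Var x \<in> U" using U rep_open by auto
    then obtain s where "s \<in> U" "tm_wb s (Var x)" using U(1) by (auto simp: tm_open_def)
    then show "x \<in> (\<Union>y\<in>{y. Var y \<in> U}. {x. way_below X y x})"
      by (auto elim: tm_wb_VarE)
  next
    fix x assume "x \<in> (\<Union>y\<in>{y. Var y \<in> U}. {x. way_below X y x})"
    then obtain y where y: "Var y \<in> U" "way_below X y x" by blast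
    then have "tm_le (Var y) (Var x)" by (intro tm_le.Var way_below_imp_spec_le)
    then have "Var x \<in> U" using U(1) y(1) unfolding tm_open_def by blast
    then show "x \<in> {x \<in> topspace X. rep (Var x) \<in> W}"
      using U rep_open y(2) by (auto simp: way_below_def intro: wf_terms.Var)
  qed
  then show "openin X {x \<in> topspace X. rep (Var x) \<in> W}"
    using openin_way_above[OF cont_X] by (auto intro: openin_Union)
qed

section \<open>Evaluation of terms in an algebra\<close>

context
  fixes A :: "'a topology" and f :: "'i \<Rightarrow> (nat \<Rightarrow> 'a) \<Rightarrow> 'a" and \<eta> :: "'x \<Rightarrow> 'a"
  assumes A: "DTop_obj I ar E A f" and \<eta>: "continuous_map X A \<eta>"
begin

abbreviation ev :: "('i, 'x) trm \<Rightarrow> 'a" where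
  "ev t \<equiv> term_ext f \<eta> t"

lemma continuous_map_op: "i \<in> I \<Longrightarrow> continuous_map (dtop_power A (ar i)) A (f i)"
  using A by (simp add: DTop_obj_def dtop_algebra_def)

lemma op_closed:
  assumes "i \<in> I" "a \<in> (\<Pi>\<^sub>E j\<in>{..<ar i}. topspace A)"
  shows "f i a \<in> topspace A"
  using continuous_map_op[OF assms(1)] assms(2) by (auto simp: continuous_map_def topspace_dtop_power)

lemma ev_closed: "t \<in> T \<Longrightarrow> ev t \<in> topspace A"
proof (induction rule: wf_terms_tm_induct)
  case (Var x)
  then show ?case using \<eta> by (auto simp: continuous_map_def)
next
  case (tm_op i a)
  have "(\<lambda>j\<in>{..<ar i}. ev (a j)) \<in> (\<Pi>\<^sub>E j\<in>{..<ar i}. topspace A)"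
    by (intro restrict_PiE_iff[THEN iffD2] ballI) (simp add: tm_op.IH)
  then show ?case using op_closed[OF tm_op(1)] by simp
qed

lemma ev_subst:
  assumes "s \<in> wf_terms I ar UNIV" "\<And>v. h v \<in> T"
  shows "ev (subst h s) = term_ext f (\<lambda>v. ev (h v)) s"
proof -
  have "subst h s \<in> T \<and> ev (subst h s) = term_ext f (\<lambda>v. ev (h v)) s"
    using assms by (intro term_ext_hom) (auto intro!: tm_op_wf)
  then show ?thesis ..
qed

lemma tm_le_ev: "tm_le t u \<Longrightarrow> spec_le A (ev t) (ev u)"
proof (induction rule: tm_le.induct)
  case (refl t)
  then show ?case by (simp add: ev_closed spec_le_refl)
next
  case (trans s t u)
  then show ?case using spec_le_trans by metis
next
  case (Var x y)
  then show ?case using continuous_map_spec_le[OF \<eta>] by simp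
next
  case (Op i a b)
  have "spec_le (dtop_power A (ar i)) (\<lambda>j\<in>{..<ar i}. ev (a j)) (\<lambda>j\<in>{..<ar i}. ev (b j))"
    using Op(3) by (auto simp: spec_le_dtop_power topspace_dtop_power spec_le_iff[of A])
  then show ?case using continuous_map_spec_le[OF continuous_map_op[OF Op(1)]] by simp
next
  case (ineq s t h)
  have "(\<lambda>v. ev (h v)) \<in> UNIV \<rightarrow> topspace A" using ineq(2) ev_closed by auto
  then have "spec_le A (term_ext f (\<lambda>v. ev (h v)) s) (term_ext f (\<lambda>v. ev (h v)) t)"
    using A ineq(1) unfolding DTop_obj_def satisfies_ineqs_def by fast
  moreover have "s \<in> wf_terms I ar UNIV" "t \<in> wf_terms I ar UNIV" using ineqs_wf ineq(1) by auto
  ultimately show ?case using ev_subst ineq(2) by simp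
qed

text \<open>Approximating the leaves of a term approximates its value: this holds for the unit since \<open>X\<close>
  is continuous, and it is passed on by the operations, which are continuous on the power.\<close>

lemma dconv_ev: "t \<in> T \<Longrightarrow> dconv A (ev ` {s. tm_wb s t}) (ev t)"
proof (induction rule: wf_terms_tm_induct)
  case (Var x)
  have "dconv A (\<eta> ` {y. way_below X y x}) (\<eta> x)"
    using continuous_map_dconv[OF \<eta> continuous_space_dconv[OF cont_X Var]] .
  moreover have "ev ` {s. tm_wb s (Var x)} = \<eta> ` {y. way_below X y x}"
    by (force elim: tm_wb_VarE intro: tm_wb.Var)
  ultimately show ?case by simp
next
  case (tm_op i a)
  let ?D = "\<Pi>\<^sub>E j\<in>{..<ar i}. ev ` {s. tm_wb s (a j)}"
  let ?a = "\<lambda>j\<in>{..<ar i}. ev (a j)"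
  have "dconv (dtop_power A (ar i)) ?D ?a"
    using tm_op.IH by (intro dconv_dtop_power) auto
  then have conv: "dconv A (f i ` ?D) (f i ?a)"
    using continuous_map_dconv[OF continuous_map_op[OF tm_op(1)]] by blast
  have "f i ` ?D = ev ` {s. tm_wb s (tm_op ar i a)}"
  proof (intro equalityI subsetI)
    fix z assume "z \<in> f i ` ?D"
    then obtain d where d: "d \<in> ?D" "z = f i d" by blast
    then have "\<exists>s. tm_wb s (a j) \<and> d j = ev s" if "j < ar i" for j
      using PiE_mem[OF d(1), of j] that by auto
    then obtain s where s: "\<And>j. j < ar i \<Longrightarrow> tm_wb (s j) (a j) \<and> d j = ev (s j)" by metis
    have "d = (\<lambda>j\<in>{..<ar i}. ev (s j))"
      using d(1) s by (intro extensionalityI[of d "{..<ar i}"]) (auto simp: PiE_iff)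
    then have "z = ev (tm_op ar i s)" using d(2) by simp
    moreover have "tm_wb (tm_op ar i s) (tm_op ar i a)" using tm_op(1) s by (intro tm_wb.Op) auto
    ultimately show "z \<in> ev ` {s. tm_wb s (tm_op ar i a)}" by blast
  next
    fix z assume "z \<in> ev ` {s. tm_wb s (tm_op ar i a)}"
    then obtain s where s: "tm_wb s (tm_op ar i a)" "z = ev s" by blast
    from s(1) obtain c where c: "s = tm_op ar i c" "\<And>j. j < ar i \<Longrightarrow> tm_wb (c j) (a j)"
      by (rule tm_wb_opE) blast
    have "(\<lambda>j\<in>{..<ar i}. ev (c j)) \<in> ?D" using c(2) by auto
    then show "z \<in> f i ` ?D" using s(2) c(1) by auto
  qed
  then show ?case using conv by simp
qed

lemma tm_open_ev_preimage:
  assumes V: "openin A V"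
  shows "tm_open {t \<in> T. ev t \<in> V}"
  unfolding tm_open_def
proof (intro conjI allI impI ballI)
  show "u \<in> {t \<in> T. ev t \<in> V}" if "tm_le t u" "t \<in> {t \<in> T. ev t \<in> V}" for t u
    using that tm_le_ev[OF that(1)] tm_le_wf[OF that(1)] V by (simp add: spec_le_iff)
  show "\<exists>s\<in>{t \<in> T. ev t \<in> V}. tm_wb s t" if t: "t \<in> {t \<in> T. ev t \<in> V}" for t
  proof -
    have "ev ` {s. tm_wb s t} \<inter> V \<noteq> {}" using t V dconv_ev[of t] by (simp add: dconv_def)
    then show ?thesis using tm_wb_wf by blast
  qed
qed auto

text \<open>Preimages of open sets under evaluation are open sets of terms, so terms with the same
  neighbourhoods have values with the same neighbourhoods; these are equal as \<open>A\<close> is \<open>T\<^sub>0\<close>.\<close>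

lemma ev_rep:
  assumes t: "t \<in> T"
  shows "ev (rep t) = ev t"
proof (rule ccontr)
  assume "ev (rep t) \<noteq> ev t"
  moreover have "t0_space A" using A by (simp add: DTop_obj_def dtop_algebra_def directed_space_def)
  ultimately obtain V where V: "openin A V" "(ev (rep t) \<notin> V) = (ev t \<in> V)"
    using t ev_closed unfolding t0_space_def by (metis rep_wf)
  then show False using rep_open[OF tm_open_ev_preimage[OF V(1)], of t] t by auto
qed

lemma dtop_hom_ev: "dtop_hom I ar tm_alg alg_op A f ev"
  unfolding dtop_hom_def
proof (intro conjI ballI)
  show "continuous_map tm_alg A ev"
    unfolding continuous_map_def
  proof (intro conjI allI impI)
    show "ev \<in> topspace tm_alg \<rightarrow> topspace A" using ev_closed by auto
    fix V assume "openin A V"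
    then have "tm_open {t \<in> T. ev t \<in> V}" by (rule tm_open_ev_preimage)
    moreover have "{t \<in> topspace tm_alg. ev t \<in> V} = {t \<in> T. ev t \<in> V} \<inter> rep ` T" by auto
    ultimately show "openin tm_alg {t \<in> topspace tm_alg. ev t \<in> V}"
      unfolding openin_tm_alg by blast
  qed
  fix i a assume i: "i \<in> I" and a: "a \<in> topspace (dtop_power tm_alg (ar i))"
  then have "tm_op ar i a \<in> T" by (intro tm_op_wf rep_image_wf) (simp_all add: topspace_dtop_power PiE_iff)
  then show "ev (alg_op i a) = f i (\<lambda>j\<in>{..<ar i}. ev (a j))"
    by (simp add: alg_op_def ev_rep)
qed

end

text \<open>The map \<open>k\<close> comes from the universal property for targets carried by terms. The composite
  \<open>A \<rightarrow> tm_alg \<rightarrow> A\<close> extends \<open>\<eta>\<close>, as does the identity, so the two agree by the uniqueness part of the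
  universal property for targets carried by the type of \<open>A\<close>. In particular every element of \<open>A\<close> is the
  value of a term.\<close>

lemma free_inverse:
  fixes A :: "'a topology"
  assumes free: "free_dtop_algebra I ar E X A f \<eta>"
  shows "\<exists>k. continuous_map A tm_alg k \<and> (\<forall>t\<in>T. k (term_ext f \<eta> t) = rep t) \<and>
    (\<forall>a\<in>topspace A. term_ext f \<eta> (k a) = a)"
proof -
  have A: "DTop_obj I ar E A f" and \<eta>: "continuous_map X A \<eta>"
    and uA: "universal_arrow TYPE('a) I ar E X A f \<eta>"
    and uT: "universal_arrow TYPE(('i, 'x) trm) I ar E X A f \<eta>"
    using free by (auto simp: free_dtop_algebra_def)
  let ?ev = "term_ext f \<eta>"
  note ev_hom = dtop_hom_ev[OF A \<eta>]
  obtain k where k: "dtop_hom I ar A f tm_alg alg_op k" "\<And>x. x \<in> topspace X \<Longrightarrow> k (\<eta> x) = rep (Var x)"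
    using ex1_implies_ex[OF universal_arrowD[OF uT DTop_obj_tm_alg continuous_map_rep_Var]] by blast
  have kc: "continuous_map A tm_alg k" using k(1) by (simp add: dtop_hom_def)
  have k_ev: "k (?ev t) = rep t" if t: "t \<in> T" for t
  proof -
    have "?ev t \<in> topspace A \<and> k (?ev t) = term_ext alg_op (\<lambda>x. k (\<eta> x)) t"
      using t
    proof (rule term_ext_hom)
      show "\<eta> x \<in> topspace A" if "x \<in> topspace X" for x
        using that \<eta> by (auto simp: continuous_map_def)
      show "f i a \<in> topspace A" if "i \<in> I" "a \<in> (\<Pi>\<^sub>E j\<in>{..<ar i}. topspace A)" for i a
        using op_closed[OF A \<eta> that] .
      show "k (f i a) = alg_op i (\<lambda>j\<in>{..<ar i}. k (a j))"
        if "i \<in> I" "a \<in> (\<Pi>\<^sub>E j\<in>{..<ar i}. topspace A)" for i a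
        using k(1) that by (simp add: dtop_hom_def topspace_dtop_power)
    qed
    moreover have "term_ext alg_op (\<lambda>x. k (\<eta> x)) t = term_ext alg_op (\<lambda>x. rep (Var x)) t"
      using t by (induction rule: wf_terms_tm_induct) (simp_all add: k(2) cong: restrict_cong)
    moreover have "rep (term_ext (tm_op ar) Var t) = term_ext alg_op (\<lambda>x. rep (Var x)) t"
      using t by (rule rep_term_ext) (rule wf_terms.Var)
    ultimately show ?thesis using term_ext_Var[OF t] by simp
  qed
  have k_in: "k a \<in> rep ` T" if "a \<in> topspace A" for a
    using kc that by (auto simp: continuous_map_def)
  have ev_k: "?ev (k a) = a" if a: "a \<in> topspace A" for a
  proof -
    let ?P = "\<lambda>k'. k' \<in> extensional (topspace A) \<and> dtop_hom I ar A f A f k' \<and>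
               (\<forall>x\<in>topspace X. k' (\<eta> x) = \<eta> x)"
    have uniq: "\<exists>!k'. ?P k'"
      using universal_arrowD[OF uA A \<eta>] .
    have alg: "dtop_algebra I ar A f" using A by (simp add: DTop_obj_def)
    have \<eta>_in: "\<eta> x \<in> topspace A" if "x \<in> topspace X" for x
      using that \<eta> by (auto simp: continuous_map_def)
    have "dtop_hom I ar A f A f (\<lambda>a\<in>topspace A. a)"
      using dtop_hom_restrict[OF alg dtop_hom_id] .
    then have "?P (\<lambda>a\<in>topspace A. a)" using \<eta>_in by simp
    moreover have "dtop_hom I ar A f A f (\<lambda>a\<in>topspace A. ?ev (k a))"
      using dtop_hom_restrict[OF alg dtop_hom_compose[OF k(1) ev_hom]] .
    moreover have "?ev (k (\<eta> x)) = \<eta> x" if x: "x \<in> topspace X" for x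
      using k(2)[OF x] ev_rep[OF A \<eta> wf_terms.Var[OF x]] by simp
    then have "\<forall>x\<in>topspace X. (\<lambda>a\<in>topspace A. ?ev (k a)) (\<eta> x) = \<eta> x"
      using \<eta>_in by simp
    ultimately have "(\<lambda>a\<in>topspace A. ?ev (k a)) = (\<lambda>a\<in>topspace A. a)"
      using uniq restrict_extensional by blast
    from fun_cong[OF this, of a] a show ?thesis by simp
  qed
  show ?thesis using kc k_ev ev_k by blast
qed

section \<open>Way-below in the free algebra\<close>

text \<open>The preimage of \<open>tm_above s\<close> under the isomorphism of \<open>A\<close> with the algebra of representatives
  is an open neighbourhood of the value of \<open>t\<close> consisting of elements above the value of \<open>s\<close>.\<close>

lemma free_way_below:
  assumes free: "free_dtop_algebra I ar E X A f \<eta>" and st: "tm_wb s t"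
  shows "way_below A (term_ext f \<eta> s) (term_ext f \<eta> t)"
proof -
  have A: "DTop_obj I ar E A f" and \<eta>: "continuous_map X A \<eta>"
    using free by (auto simp: free_dtop_algebra_def)
  obtain k where k: "continuous_map A tm_alg k"
    "\<And>t. t \<in> T \<Longrightarrow> k (term_ext f \<eta> t) = rep t"
    "\<And>a. a \<in> topspace A \<Longrightarrow> term_ext f \<eta> (k a) = a"
    using free_inverse[OF free] by blast
  have wf: "s \<in> T" "t \<in> T" using tm_wb_wf st by auto
  let ?V = "{a \<in> topspace A. k a \<in> tm_above s \<inter> rep ` T}"
  show ?thesis
  proof (rule way_below_openI)
    have "openin tm_alg (tm_above s \<inter> rep ` T)"
      using tm_open_above openin_tm_alg by blast
    then show "openin A ?V" using k(1) by (rule openin_continuous_map_preimage[rotated])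
    have "rep t \<in> tm_above s" using rep_open[OF tm_open_above] tm_above_wb[OF st] by blast
    then show "term_ext f \<eta> t \<in> ?V" using k(2)[OF wf(2)] ev_closed[OF A \<eta> wf(2)] wf(2) by simp
    show "term_ext f \<eta> s \<in> topspace A" using ev_closed[OF A \<eta> wf(1)] .
    fix a assume a: "a \<in> ?V"
    then have "tm_le s (k a)" using tm_above_imp_le by blast
    then show "spec_le A (term_ext f \<eta> s) a" using tm_le_ev[OF A \<eta>] k(3) a by fastforce
  qed
qed

lemma free_generated:
  assumes free: "free_dtop_algebra I ar E X A f \<eta>" and a: "a \<in> topspace A"
  obtains t where "t \<in> T" "a = term_ext f \<eta> t"
proof -
  obtain k where k: "continuous_map A tm_alg k"
    "\<And>t. t \<in> T \<Longrightarrow> k (term_ext f \<eta> t) = rep t"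
    "\<And>a. a \<in> topspace A \<Longrightarrow> term_ext f \<eta> (k a) = a"
    using free_inverse[OF free] by blast
  have "k a \<in> rep ` T" using k(1) a by (simp add: continuous_map_def Pi_iff)
  then show ?thesis using that[OF rep_image_wf] k(3)[OF a] by simp
qed

lemma continuous_space_free:
  assumes free: "free_dtop_algebra I ar E X A f \<eta>"
  shows "continuous_space A"
  unfolding continuous_space_def
proof (intro conjI ballI)
  have A: "DTop_obj I ar E A f" and \<eta>: "continuous_map X A \<eta>"
    using free by (auto simp: free_dtop_algebra_def)
  show "directed_space A" using A by (simp add: DTop_obj_def dtop_algebra_def)
  fix a assume "a \<in> topspace A"
  then obtain t where t: "t \<in> T" "a = term_ext f \<eta> t" by (rule free_generated[OF free])
  have "term_ext f \<eta> ` {s. tm_wb s t} \<subseteq> {y. way_below A y a}"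
    using free_way_below[OF free] t(2) by blast
  then show "\<exists>D\<subseteq>{y. way_below A y a}. dconv A D a"
    using dconv_ev[OF A \<eta> t(1)] t(2) by blast
qed

text \<open>Each \<open>b j\<close> is the value of a term \<open>t j\<close>, whose approximations converge to \<open>b j\<close>; so \<open>a j\<close> lies below
  the value of an approximation \<open>s j\<close> of \<open>t j\<close>. Applying the operation symbol to the \<open>s j\<close> yields an
  approximation of the term for \<open>f i b\<close>, with a value above \<open>f i a\<close>.\<close>

lemma free_op_way_below:
  assumes free: "free_dtop_algebra I ar E X A f \<eta>" and i: "i \<in> I"
    and ab: "way_below (dtop_power A (ar i)) a b"
  shows "way_below A (f i a) (f i b)"
proof -
  have A: "DTop_obj I ar E A f" and \<eta>: "continuous_map X A \<eta>"
    using free by (auto simp: free_dtop_algebra_def)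
  have mem: "a \<in> topspace (dtop_power A (ar i))" "b \<in> topspace (dtop_power A (ar i))"
    using ab by (auto simp: way_below_def)
  have "\<exists>s t. tm_wb s t \<and> b j = term_ext f \<eta> t \<and> spec_le A (a j) (term_ext f \<eta> s)" if j: "j < ar i" for j
  proof -
    have "b j \<in> topspace A" using mem(2) j by (auto simp: topspace_dtop_power)
    then obtain t where t: "t \<in> T" "b j = term_ext f \<eta> t" by (rule free_generated[OF free])
    have "way_below A (a j) (term_ext f \<eta> t)"
      using ab mem j t(2) way_below_dtop_power by metis
    then show ?thesis
      using dconv_ev[OF A \<eta> t(1)] t(2) unfolding way_below_def by blast
  qed
  then obtain s t where st: "\<And>j. j < ar i \<Longrightarrow> tm_wb (s j) (t j)"
      "\<And>j. j < ar i \<Longrightarrow> b j = term_ext f \<eta> (t j)"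
      "\<And>j. j < ar i \<Longrightarrow> spec_le A (a j) (term_ext f \<eta> (s j))"
    by metis
  have "b = (\<lambda>j\<in>{..<ar i}. term_ext f \<eta> (t j))"
  proof (rule extensionalityI[of _ "{..<ar i}"])
    show "b \<in> extensional {..<ar i}" using mem(2) by (simp add: topspace_dtop_power PiE_iff)
    show "b j = (\<lambda>j\<in>{..<ar i}. term_ext f \<eta> (t j)) j" if "j \<in> {..<ar i}" for j
      using that st(2)[of j] by simp
  qed simp
  then have b: "f i b = term_ext f \<eta> (tm_op ar i t)" by simp
  have "spec_le (dtop_power A (ar i)) a (\<lambda>j\<in>{..<ar i}. term_ext f \<eta> (s j))"
    using mem(1) st(3) by (auto simp: spec_le_dtop_power topspace_dtop_power spec_le_iff[of A])
  then have "spec_le A (f i a) (term_ext f \<eta> (tm_op ar i s))"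
    using continuous_map_spec_le[OF continuous_map_op[OF A \<eta> i]] by simp
  moreover have "way_below A (term_ext f \<eta> (tm_op ar i s)) (f i b)"
    unfolding b using st(1) i by (intro free_way_below[OF free] tm_wb.Op)
  ultimately show ?thesis
    using way_below_mono spec_le_refl by (metis way_below_def)
qed

end

theorem proposition7p6:
  fixes I :: "'i set" and ar :: "'i \<Rightarrow> nat"
    and E :: "(('i, nat) trm \<times> ('i, nat) trm) set"
    and X :: "'x topology"
    and A :: "'a topology" and f :: "'i \<Rightarrow> (nat \<Rightarrow> 'a) \<Rightarrow> 'a" and \<eta> :: "'x \<Rightarrow> 'a"
  assumes "E \<subseteq> wf_terms I ar UNIV \<times> wf_terms I ar UNIV"
    and "continuous_space X"
    and "free_dtop_algebra I ar E X A f \<eta>"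
  shows "continuous_space A \<and> way_below_preserving X A \<eta> \<and>
    (\<forall>i\<in>I. way_below_preserving (dtop_power A (ar i)) A (f i))"
proof -
  interpret terms_over_continuous_space I ar E X using assms(1,2) by unfold_locales
  note free = assms(3)
  have A: "continuous_space A" using continuous_space_free[OF free] .
  have "way_below A (\<eta> x) (\<eta> y)" if "way_below X x y" for x y
    using free_way_below[OF free tm_wb.Var[OF that]] by simp
  moreover have "continuous_map X A \<eta>" "DTop_obj I ar E A f"
    using free by (auto simp: free_dtop_algebra_def)
  ultimately show ?thesis
    using A assms(2) free_op_way_below[OF free] continuous_space_dtop_power[OF A]
    by (auto simp: way_below_preserving_def DTop_obj_def dtop_algebra_def)
qed

end
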